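(* Let $n$ take values only in an infinite set of odd square-free integers greater than $1$ such that \[ \frac{(\log n)^3}{p_n}\to 0 \quad\text{as } n\to\infty, \] where $p_n$ is the smallest prime factor of $n$, and let $r$ be real. Let $J(z)=\sum_{j=1}^{n-1}\left(\frac{j}{n}\right)z^j$ be the character polynomial of degree $n-1$. Then \[ \lim_{n\to\infty}F(J_r)=f(r). \]
   Context: For real $\alpha\ge1$ and $A\in\mathbb{C}[z]$, $\|A\|_\alpha=\left(\frac{1}{2\pi}\int_0^{2\pi}|A(e^{i\theta})|^\alpha d\theta\right)^{1/\alpha}$. The merit factor of $A$ is $F(A)=\frac{\|A\|_2^4}{\|A\|_4^4-\|A\|_2^4}$ (when the denominator is nonzero). For a polynomial $A$ of degree $n-1$ and real $r$, the rotation is $A_r(z)=z^{-\lfloor nr\rfloor}A(z)\bmod (z^n-1)$ (a polynomial of degree at most $n-1$). $\left(\frac{\cdot}{n}\right)$ denotes the Jacobi symbol. The function $f$ is defined by $f(r)=\dfrac{1}{\frac16+8\left(|r|-\frac14\right)^2}$ for $-\frac12<r\le\frac12$ and $f(r)=f(r+1)$ otherwise (i.e. $f$ is $1$-periodic). *)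

theory Defs
  imports "HOL-Analysis.Analysis" "HOL-Number_Theory.Residues"
    "HOL-Computational_Algebra.Computational_Algebra"
begin

definition Jacobi :: "int \<Rightarrow> nat \<Rightarrow> int" where
  "Jacobi a n = (\<Prod>p\<in>prime_factors n. Legendre a (int p) ^ multiplicity p n)"

definition lnorm :: "real \<Rightarrow> complex poly \<Rightarrow> real" where
  "lnorm \<alpha> A = ((1 / (2 * pi)) * integral {0..2*pi} (\<lambda>\<theta>. cmod (poly A (cis \<theta>)) powr \<alpha>)) powr (1 / \<alpha>)"

definition merit_factor :: "complex poly \<Rightarrow> real" where
  "merit_factor A = lnorm 2 A ^ 4 / (lnorm 4 A ^ 4 - lnorm 2 A ^ 4)"

(* A_r(z) = z^{-floor(n r)} A(z) mod (z^n - 1): coefficient k is a_{(k + floor(n r)) mod n} *)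
definition rotation :: "nat \<Rightarrow> real \<Rightarrow> complex poly \<Rightarrow> complex poly" where
  "rotation n r A = (\<Sum>k<n. Polynomial.monom (Polynomial.coeff A (nat ((int k + \<lfloor>real n * r\<rfloor>) mod int n))) k)"

definition char_poly :: "nat \<Rightarrow> complex poly" where
  "char_poly n = (\<Sum>j\<in>{1..<n}. Polynomial.monom (of_int (Jacobi (int j) n)) j)"

(* f on (-1/2,1/2], extended 1-periodically *)
definition f_base :: "real \<Rightarrow> real" where
  "f_base r = 1 / (1/6 + 8 * (\<bar>r\<bar> - 1/4)^2)"

definition f_per :: "real \<Rightarrow> real" where
  "f_per r = f_base (r - of_int \<lceil>r - 1/2\<rceil>)"

definition smallest_prime_factor :: "nat \<Rightarrow> nat" where
  "smallest_prime_factor n = Min (prime_factors n)"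

end

theory Submission
  imports Defs "HOL-Number_Theory.Euler_Criterion"
begin

text \<open>
  Let \<open>a j = (j + R | n)\<close> with \<open>R = \<lfloor>n r\<rfloor>\<close>, and let \<open>C u\<close> be its aperiodic autocorrelations, so that
  the merit factor is \<open>(C 0)\<^sup>2\<close> divided by twice the sum of \<open>(C u)\<^sup>2\<close> over \<open>0 < u < n\<close>. A residue
  \<open>u \<noteq> 0\<close> modulo \<open>n\<close> is hit only by the differences \<open>u\<close> and \<open>u - n\<close>, hence
  \<open>n * C u = L u + (n - u) * P u\<close>, where \<open>P\<close> is the periodic autocorrelation and \<open>L\<close> is the periodic
  autocorrelation with each product \<open>a j * a l\<close> weighted by \<open>j - l\<close>. By Parseval and
  \<open>\<bar>G\<bar>\<^sup>2 = n\<close> for the Gauss sum \<open>G\<close>, the contribution of \<open>P\<close> is negligible. The discrete Fourier transform of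
  \<open>L\<close> is \<open>2\<i> Im (D k * cnj (E k))\<close>, with \<open>E\<close> and \<open>D\<close> the transforms of \<open>a j\<close> and \<open>j * a j\<close>. Since
  \<open>E k\<close> is explicit, \<open>(k | n)\<^sup>2 = 1\<close> for most \<open>k\<close>, and \<open>cnj (G)\<^sup>2 = (-1 | n) * n\<close>, the sum of \<open>(L u)\<^sup>2\<close>
  collapses to the elementary sum of \<open>j * (j - \<sigma> j)\<close>, where \<open>\<sigma> j\<close> is \<open>-2R - j\<close> reduced modulo \<open>n\<close>.
  No bound for character sums of degree four is needed. The error comes from the at most
  \<open>n * ln n / p\<close> residues \<open>k\<close> not coprime to \<open>n\<close>, where \<open>\<bar>D k\<bar>\<^sup>2 \<le> n\<^sup>3 * (ln n)\<^sup>2\<close>; this is exactly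
  what the hypothesis on \<open>(ln n)\<^sup>3 / p\<close> controls.
\<close>

subsection \<open>The Jacobi symbol of a square-free modulus\<close>

lemma Legendre_cong:
  assumes "[a = b] (mod p)"
  shows "Legendre a p = Legendre b p"
proof -
  have "[a = 0] (mod p) \<longleftrightarrow> [b = 0] (mod p)"
    using assms cong_sym cong_trans by blast
  moreover have "QuadRes p a \<longleftrightarrow> QuadRes p b"
    unfolding QuadRes_def using assms cong_sym cong_trans by blast
  ultimately show ?thesis
    by (simp add: Legendre_def)
qed

lemma Legendre_values: "Legendre a p \<in> {-1, 0, 1}"
  by (simp add: Legendre_def)

lemma Legendre_eq_0_iff: "Legendre a p = 0 \<longleftrightarrow> p dvd a"
  by (simp add: Legendre_def cong_0_iff)

text \<open>By Euler's criterion both sides are congruent to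
  \<open>(a * b) ^ ((p - 1) div 2)\<close> modulo \<open>p\<close>. Both lie in {-1, 0, 1}, so they
  differ by at most 2, which is less than \<open>p\<close>.\<close>

lemma Legendre_mult:
  assumes "prime p" "2 < p"
  shows "Legendre (a * b) (int p) = Legendre a (int p) * Legendre b (int p)"
proof -
  have euler: "[Legendre c (int p) = c ^ ((p - 1) div 2)] (mod int p)" for c
    using euler_criterion[OF assms] .
  have "[Legendre a (int p) * Legendre b (int p) = (a * b) ^ ((p - 1) div 2)] (mod int p)"
    unfolding power_mult_distrib by (intro cong_mult euler)
  then have "[Legendre (a * b) (int p) = Legendre a (int p) * Legendre b (int p)] (mod int p)"
    using euler cong_sym cong_trans by blast
  then have "int p dvd Legendre (a * b) (int p) - Legendre a (int p) * Legendre b (int p)"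
    by (simp add: cong_iff_dvd_diff)
  moreover have "\<bar>Legendre (a * b) (int p) - Legendre a (int p) * Legendre b (int p)\<bar> < int p"
    using Legendre_values[of "a * b" "int p"] Legendre_values[of a "int p"]
      Legendre_values[of b "int p"] \<open>2 < p\<close> by auto
  ultimately show ?thesis
    by (metis abs_of_nat dvd_imp_le_int eq_iff_diff_eq_0 not_le)
qed

text \<open>Squaring identifies 1 with \<open>p - 1\<close>, so on the finite set of residues it is
  not injective and hence not surjective. A residue that it misses is a nonresidue, and it is
  nonzero because 0 is a square.\<close>

lemma exists_quadratic_nonresidue:
  assumes "prime p" "2 < p"
  shows "\<exists>a. Legendre a (int p) = -1"
proof -
  let ?h = "\<lambda>y::int. y^2 mod int p"
  have "\<not> inj_on ?h {0..<int p}"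
  proof
    assume inj: "inj_on ?h {0..<int p}"
    have "(int p - 1)^2 = 1 + int p * (int p - 2)"
      by (simp add: power2_eq_square algebra_simps)
    then have "?h (int p - 1) = ?h 1" by (metis mod_mult_self2 power_one)
    with inj have "int p - 1 = 1"
      by (rule inj_onD) (use \<open>2 < p\<close> in auto)
    then show False using \<open>2 < p\<close> by simp
  qed
  moreover have "?h ` {0..<int p} \<subseteq> {0..<int p}"
    using \<open>2 < p\<close> by auto
  ultimately have "?h ` {0..<int p} \<noteq> {0..<int p}"
    using eq_card_imp_inj_on[of "{0..<int p}" ?h] by auto
  then obtain a where a: "a \<in> {0..<int p}" "a \<notin> ?h ` {0..<int p}"
    using \<open>?h ` _ \<subseteq> _\<close> by blast
  have "\<not> QuadRes (int p) a"
  proof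
    assume "QuadRes (int p) a"
    then obtain y where "y^2 mod int p = a mod int p"
      by (auto simp: QuadRes_def cong_def)
    then have "?h (y mod int p) = a"
      using a by (simp add: power_mod)
    moreover have "y mod int p \<in> {0..<int p}"
      using \<open>2 < p\<close> by simp
    ultimately show False using a by blast
  qed
  moreover have "\<not> [a = 0] (mod int p)"
  proof
    assume "[a = 0] (mod int p)"
    then have "[0\<^sup>2 = a] (mod int p)" by (simp add: cong_sym)
    with \<open>\<not> QuadRes (int p) a\<close> show False unfolding QuadRes_def by blast
  qed
  ultimately show ?thesis
    by (auto simp: Legendre_def)
qed

context
  fixes n :: nat
  assumes odd_n: "odd n" and squarefree_n: "squarefree n"
begin

lemma prime_factor_gt_2: "p \<in> prime_factors n \<Longrightarrow> prime p \<and> 2 < p \<and> p dvd n"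
  using odd_n by (metis in_prime_factors_imp_dvd in_prime_factors_imp_prime nat_less_le prime_ge_2_nat)

lemma Jacobi_eq_prod: "Jacobi a n = (\<Prod>p\<in>prime_factors n. Legendre a (int p))"
  unfolding Jacobi_def
proof (rule prod.cong[OF refl])
  fix p assume p: "p \<in> prime_factors n"
  then have "prime p" "p dvd n" "n \<noteq> 0"
    using prime_factor_gt_2 odd_n by (auto intro: Nat.gr0I)
  then have "multiplicity p n = 1"
    using squarefree_n by (metis squarefree_factorial_semiring' p)
  then show "Legendre a (int p) ^ multiplicity p n = Legendre a (int p)" by simp
qed

lemma Jacobi_cong:
  assumes "[a = b] (mod int n)"
  shows "Jacobi a n = Jacobi b n"
  unfolding Jacobi_eq_prod
proof (intro prod.cong refl Legendre_cong)
  fix p assume "p \<in> prime_factors n"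
  then have "int p dvd int n" by auto
  then show "[a = b] (mod int p)" using assms cong_dvd_modulus by blast
qed

lemma Jacobi_mult: "Jacobi (a * b) n = Jacobi a n * Jacobi b n"
  unfolding Jacobi_eq_prod prod.distrib[symmetric]
  by (intro prod.cong refl Legendre_mult) (use prime_factor_gt_2 in auto)

lemma Jacobi_values: "Jacobi a n \<in> {-1, 0, 1}"
proof -
  have "finite A \<Longrightarrow> (\<Prod>p\<in>A. Legendre a (int p)) \<in> {-1, 0, 1}" for A
  proof (induction A rule: finite_induct)
    case (insert p A)
    then show ?case using Legendre_values[of a "int p"] by auto
  qed simp
  then show ?thesis by (simp add: Jacobi_eq_prod)
qed

lemma Jacobi_eq_0_iff: "Jacobi a n = 0 \<longleftrightarrow> (\<exists>p\<in>prime_factors n. int p dvd a)"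
  by (simp add: Jacobi_eq_prod Legendre_eq_0_iff)

text \<open>This expresses primitivity: multiplication by \<open>a\<close> fixes every multiple of
  \<open>p\<close> modulo \<open>n\<close> but flips the sign of the symbol. Since \<open>n\<close>
  is square-free, \<open>p\<close> is coprime to \<open>n div p\<close>, and the Chinese remainder
  theorem combines a nonresidue modulo \<open>p\<close> with 1 modulo
  \<open>n div p\<close>.\<close>

lemma exists_unit_Jacobi_eq_minus_1:
  assumes "p \<in> prime_factors n"
  shows "\<exists>a. Jacobi a n = -1 \<and> [a = 1] (mod int (n div p))"
proof -
  have p: "prime p" "2 < p" "p dvd n"
    using prime_factor_gt_2[OF assms] by auto
  then obtain b where b: "Legendre b (int p) = -1"
    using exists_quadratic_nonresidue by blast
  have n: "n = p * (n div p)" using p by simp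
  have "\<not> p dvd n div p"
  proof
    assume "p dvd n div p"
    then have "p\<^sup>2 dvd n" using n by (metis dvd_triv_left mult_dvd_mono power2_eq_square dvd_refl)
    then show False using squarefree_n p by (auto dest: squarefreeD)
  qed
  then have "coprime p (n div p)" using p prime_imp_coprime by blast
  then have "coprime (int p) (int (n div p))" by simp
  from binary_chinese_remainder_int[OF this, of b 1]
  obtain a where a: "[a = b] (mod int p)" "[a = 1] (mod int (n div p))" by blast
  have "Legendre a (int q) = 1" if q: "q \<in> prime_factors n - {p}" for q
  proof -
    have q': "prime q" "2 < q" "q dvd n" using prime_factor_gt_2[of q] q by auto
    have "q dvd n div p"
      using n q q' p by (metis DiffD2 prime_dvd_mult_iff primes_dvd_imp_eq singletonI)
    then have "[a = 1] (mod int q)"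
      using a cong_dvd_modulus of_nat_dvd_iff by blast
    then have "Legendre a (int q) = Legendre 1 (int q)" by (rule Legendre_cong)
    also have "QuadRes (int q) 1" unfolding QuadRes_def by (auto intro!: exI[of _ 1])
    then have "Legendre 1 (int q) = 1"
      using q' by (auto simp: Legendre_def cong_0_iff)
    finally show ?thesis .
  qed
  then have "Jacobi a n = Legendre a (int p)"
    unfolding Jacobi_eq_prod prod.remove[OF finite_set_mset assms] by simp
  then have "Jacobi a n = -1" using b Legendre_cong[OF a(1)] by simp
  then show ?thesis using a by blast
qed

end

subsection \<open>Complete sums and exponentials modulo an integer\<close>

lemma bij_betw_mod:
  fixes N :: int
  assumes "N > 0" and "\<And>x y. [h x = h y] (mod N) \<Longrightarrow> [x = y] (mod N)"
  shows "bij_betw (\<lambda>x. h x mod N) {0..<N} {0..<N}"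
proof -
  have "inj_on (\<lambda>x. h x mod N) {0..<N}"
  proof (rule inj_onI)
    fix x y assume *: "x \<in> {0..<N}" "y \<in> {0..<N}" "h x mod N = h y mod N"
    have "[x = y] (mod N)" by (rule assms(2)) (use * in \<open>simp add: cong_def\<close>)
    with * show "x = y" by (simp add: cong_def)
  qed
  moreover have "(\<lambda>x. h x mod N) ` {0..<N} \<subseteq> {0..<N}"
    using \<open>N > 0\<close> by auto
  ultimately show ?thesis
    by (simp add: bij_betw_def endo_inj_surj)
qed

lemma sum_mod_shift:
  fixes N :: int
  assumes "N > 0" "\<And>x. g (x mod N) = g x"
  shows "(\<Sum>x\<in>{0..<N}. g (x + c)) = (\<Sum>x\<in>{0..<N}. g x)"
proof -
  have "bij_betw (\<lambda>x. (x + c) mod N) {0..<N} {0..<N}"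
    by (rule bij_betw_mod) (use assms in \<open>auto simp: cong_add_rcancel\<close>)
  from sum.reindex_bij_betw[OF this, of g] show ?thesis
    using assms by simp
qed

lemma sum_mod_mult:
  fixes N :: int
  assumes "N > 0" "\<And>x. g (x mod N) = g x" "coprime a N"
  shows "(\<Sum>x\<in>{0..<N}. g (a * x)) = (\<Sum>x\<in>{0..<N}. g x)"
proof -
  have "bij_betw (\<lambda>x. (a * x) mod N) {0..<N} {0..<N}"
    by (rule bij_betw_mod) (use assms in \<open>auto simp: cong_mult_lcancel\<close>)
  from sum.reindex_bij_betw[OF this, of g] show ?thesis
    using assms by simp
qed

text \<open>The additive character of modulus \<open>n\<close>, taken on all integers so that
  frequencies may be negative or unreduced; \<open>root_exp_cong\<close> supplies the
  periodicity.\<close>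

definition root_exp :: "nat \<Rightarrow> int \<Rightarrow> complex" where
  "root_exp n x = cis (2 * pi * of_int x / real n)"

lemma root_exp_0 [simp]: "root_exp n 0 = 1"
  by (simp add: root_exp_def)

lemma norm_root_exp [simp]: "norm (root_exp n x) = 1"
  by (simp add: root_exp_def)

lemma root_exp_add: "root_exp n (x + y) = root_exp n x * root_exp n y"
  by (simp add: root_exp_def cis_mult add_divide_distrib distrib_left)

lemma cnj_root_exp: "cnj (root_exp n x) = root_exp n (- x)"
  by (simp add: root_exp_def cis_cnj)

lemma root_exp_eq_1_iff:
  assumes "n > 0"
  shows "root_exp n x = 1 \<longleftrightarrow> int n dvd x"
proof -
  have "root_exp n x = 1 \<longleftrightarrow> cos (2 * pi * of_int x / real n) = 1"
    unfolding root_exp_def complex_eq_iff cis.sel one_complex.sel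
    using cos_one_sin_zero by blast
  also have "\<dots> \<longleftrightarrow> (\<exists>k::int. 2 * pi * of_int x / real n = of_int k * 2 * pi)"
    by (rule cos_one_2pi_int)
  also have "\<dots> \<longleftrightarrow> (\<exists>k::int. x = int n * k)"
  proof (intro ex_cong1)
    fix k :: int
    have "2 * pi * of_int x / real n = of_int k * 2 * pi \<longleftrightarrow> real_of_int x = real n * of_int k"
      using assms by (auto simp: field_simps)
    also have "\<dots> \<longleftrightarrow> x = int n * k"
      by (metis of_int_eq_iff of_int_mult of_int_of_nat_eq)
    finally show "2 * pi * of_int x / real n = of_int k * 2 * pi \<longleftrightarrow> x = int n * k" .
  qed
  finally show ?thesis by (simp add: dvd_def)
qed

lemma root_exp_cong:
  assumes "n > 0" "[x = y] (mod int n)"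
  shows "root_exp n x = root_exp n y"
proof -
  have "root_exp n (x - y) = 1"
    using assms by (simp add: root_exp_eq_1_iff cong_iff_dvd_diff)
  then show ?thesis
    using root_exp_add[of n "x - y" y] by simp
qed

lemma root_exp_mod: "n > 0 \<Longrightarrow> root_exp n (x mod int n) = root_exp n x"
  by (rule root_exp_cong) auto

lemma sum_root_exp:
  assumes "n > 0"
  shows "(\<Sum>k\<in>{0..<int n}. root_exp n (m * k)) = (if int n dvd m then of_nat n else 0)"
proof (cases "int n dvd m")
  case True
  then have "root_exp n (m * k) = 1" for k
    using assms by (simp add: root_exp_eq_1_iff)
  then show ?thesis using True by simp
next
  case False
  let ?s = "\<Sum>k\<in>{0..<int n}. root_exp n (m * k)"
  have "root_exp n (m * (x mod int n)) = root_exp n (m * x)" for x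
    using assms by (intro root_exp_cong) (auto simp: cong_def mod_mult_right_eq)
  then have "?s = (\<Sum>k\<in>{0..<int n}. root_exp n (m * (k + 1)))"
    using assms by (intro sum_mod_shift[symmetric]) auto
  also have "\<dots> = ?s * root_exp n m"
    by (simp add: distrib_left root_exp_add sum_distrib_right)
  finally have "?s * (1 - root_exp n m) = 0" by (simp add: algebra_simps)
  then show ?thesis
    using False assms by (simp add: root_exp_eq_1_iff)
qed

text \<open>Orthogonality of the additive characters. The frequencies \<open>\<alpha>\<close>,
  \<open>\<beta>\<close> and the twist \<open>m\<close> are left free so that it covers both
  Parseval (\<open>\<beta> v = - v\<close>, \<open>m = 0\<close>) and the twisted second moment of
  \<open>D\<close> (\<open>m = 2 * R\<close>).\<close>

lemma sum_mult_root_exp: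
  assumes "n > 0"
  shows "(\<Sum>k\<in>{0..<int n}. (\<Sum>j\<in>A. f j * root_exp n (\<alpha> j * k)) * (\<Sum>l\<in>B. g l * root_exp n (\<beta> l * k))
      * root_exp n (m * k))
    = of_nat n * (\<Sum>j\<in>A. \<Sum>l\<in>B. if int n dvd \<alpha> j + \<beta> l + m then f j * g l else 0)"
proof -
  have "(\<Sum>k\<in>{0..<int n}. (\<Sum>j\<in>A. f j * root_exp n (\<alpha> j * k)) * (\<Sum>l\<in>B. g l * root_exp n (\<beta> l * k))
      * root_exp n (m * k))
    = (\<Sum>k\<in>{0..<int n}. \<Sum>j\<in>A. \<Sum>l\<in>B. f j * g l * root_exp n ((\<alpha> j + \<beta> l + m) * k))"
    unfolding sum_product unfolding sum_distrib_right
    by (intro sum.cong refl) (simp add: root_exp_add distrib_right algebra_simps)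
  also have "\<dots> = (\<Sum>j\<in>A. \<Sum>l\<in>B. \<Sum>k\<in>{0..<int n}. f j * g l * root_exp n ((\<alpha> j + \<beta> l + m) * k))"
    by (simp add: sum.swap[of _ _ "{0..<int n}"])
  also have "\<dots> = (\<Sum>j\<in>A. \<Sum>l\<in>B. of_nat n * (if int n dvd \<alpha> j + \<beta> l + m then f j * g l else 0))"
    by (intro sum.cong refl) (simp add: sum_distrib_left[symmetric] sum_root_exp[OF assms])
  finally show ?thesis by (simp add: sum_distrib_left)
qed

lemma parseval_root_exp:
  assumes "n > 0"
  shows "(\<Sum>k\<in>{0..<int n}. (cmod (\<Sum>u\<in>{0..<int n}. f u * root_exp n (u * k)))\<^sup>2)
    = real n * (\<Sum>u\<in>{0..<int n}. (cmod (f u))\<^sup>2)"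
proof -
  let ?I = "{0..<int n}"
  have "complex_of_real (\<Sum>k\<in>?I. (cmod (\<Sum>u\<in>?I. f u * root_exp n (u * k)))\<^sup>2)
     = (\<Sum>k\<in>?I. (\<Sum>u\<in>?I. f u * root_exp n (u * k)) * (\<Sum>v\<in>?I. cnj (f v) * root_exp n (- v * k)) * root_exp n (0 * k))"
    unfolding of_real_sum complex_norm_square by (simp add: cnj_root_exp)
  also have "\<dots> = of_nat n * (\<Sum>u\<in>?I. \<Sum>v\<in>?I. if int n dvd u + - v + 0 then f u * cnj (f v) else 0)"
    by (rule sum_mult_root_exp[OF assms])
  also have "(\<Sum>u\<in>?I. \<Sum>v\<in>?I. if int n dvd u + - v + 0 then f u * cnj (f v) else 0)
     = (\<Sum>u\<in>?I. \<Sum>v\<in>?I. if v = u then f u * cnj (f v) else 0)"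
  proof (intro sum.cong refl if_cong)
    fix u v assume "u \<in> ?I" "v \<in> ?I"
    then show "(int n dvd u + - v + 0) = (v = u)"
      by (auto simp flip: cong_iff_dvd_diff simp: cong_def)
  qed
  also have "\<dots> = complex_of_real (\<Sum>u\<in>?I. (cmod (f u))\<^sup>2)"
    unfolding of_real_sum complex_norm_square by simp
  also have "of_nat n * \<dots> = complex_of_real (real n * (\<Sum>u\<in>?I. (cmod (f u))\<^sup>2))"
    by (simp only: of_real_mult of_real_of_nat_eq)
  finally show ?thesis by (simp only: of_real_eq_iff)
qed

subsection \<open>Gauss sums\<close>

context
  fixes n :: nat
  assumes odd_n: "odd n" and squarefree_n: "squarefree n" and n_gt_1: "n > 1"
begin

lemmas Jacobi_facts =
  Jacobi_cong[OF odd_n squarefree_n] Jacobi_mult[OF odd_n squarefree_n]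
  Jacobi_values[OF odd_n squarefree_n] Jacobi_eq_0_iff[OF odd_n squarefree_n]

lemma Jacobi_mod: "Jacobi (x mod int n) n = Jacobi x n"
  by (rule Jacobi_facts) auto

lemma Jacobi_1: "Jacobi 1 n = 1"
proof -
  have "Jacobi 1 n \<noteq> 0"
    by (auto simp: Jacobi_facts(4) dest!: in_prime_factors_imp_prime)
  moreover have "Jacobi 1 n = Jacobi 1 n * Jacobi 1 n"
    using Jacobi_facts(2)[of 1 1] by simp
  ultimately show ?thesis by simp
qed

lemma Jacobi_minus: "Jacobi (- x) n = Jacobi (- 1) n * Jacobi x n"
  using Jacobi_facts(2)[of "-1" x] by simp

lemma Jacobi_minus_1_square: "(Jacobi (- 1) n)\<^sup>2 = 1"
  using Jacobi_minus[of "-1"] by (simp add: Jacobi_1 power2_eq_square)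

lemma coprime_if_Jacobi_neq_0:
  assumes "Jacobi a n \<noteq> 0"
  shows "coprime a (int n)"
proof (rule ccontr)
  assume "\<not> coprime a (int n)"
  then have "gcd (nat \<bar>a\<bar>) n \<noteq> 1"
    by (metis coprime_iff_gcd_eq_1 gcd_int_def nat_int of_nat_1 abs_of_nat)
  then obtain p where "prime p" "p dvd gcd (nat \<bar>a\<bar>) n"
    by (meson prime_factor_nat)
  then have "p dvd nat \<bar>a\<bar>" "p dvd n"
    by (meson dvd_trans gcd_dvd1 gcd_dvd2)+
  then have "p \<in> prime_factors n" "int p dvd a"
    using n_gt_1 \<open>prime p\<close> by (auto simp: prime_factors_dvd simp flip: int_dvd_int_iff)
  then show False using assms by (auto simp: Jacobi_facts(4))
qed

definition Jacobi_Gauss_sum :: complex where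
  "Jacobi_Gauss_sum = (\<Sum>j\<in>{0..<int n}. of_int (Jacobi j n) * root_exp n j)"

text \<open>For a unit \<open>k\<close> substitute \<open>k * j\<close> for \<open>j\<close>.
  Otherwise some prime factor \<open>p\<close> of \<open>n\<close> divides \<open>k\<close>; the
  substitution of \<open>a * j\<close>, with \<open>a\<close> congruent to 1 modulo
  \<open>n div p\<close> and of symbol -1, preserves \<open>j * k\<close> modulo \<open>n\<close>
  and negates the symbol, so the sum is its own negative.\<close>

lemma sum_Jacobi_root_exp:
  "(\<Sum>j\<in>{0..<int n}. of_int (Jacobi j n) * root_exp n (j * k)) = of_int (Jacobi k n) * Jacobi_Gauss_sum"
  (is "?s = _")
proof (cases "Jacobi k n = 0")
  case False
  let ?g = "\<lambda>j. of_int (Jacobi j n) * root_exp n j"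
  have "of_int (Jacobi k n) * ?s = (\<Sum>j\<in>{0..<int n}. ?g (k * j))"
    by (simp add: sum_distrib_left Jacobi_facts(2) mult_ac)
  also have "\<dots> = Jacobi_Gauss_sum"
    unfolding Jacobi_Gauss_sum_def
    by (rule sum_mod_mult)
      (use n_gt_1 False coprime_if_Jacobi_neq_0 in \<open>auto simp: Jacobi_mod root_exp_mod\<close>)
  finally have "of_int (Jacobi k n) * (of_int (Jacobi k n) * ?s) = of_int (Jacobi k n) * Jacobi_Gauss_sum"
    by simp
  moreover have "of_int (Jacobi k n) * (of_int (Jacobi k n) * ?s) = ?s"
    using Jacobi_facts(3)[of k] False by auto
  ultimately show ?thesis by simp
next
  case True
  then obtain p where p: "p \<in> prime_factors n" "int p dvd k"
    by (auto simp: Jacobi_facts(4))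
  obtain a where a: "Jacobi a n = -1" "[a = 1] (mod int (n div p))"
    using exists_unit_Jacobi_eq_minus_1[OF odd_n squarefree_n p(1)] by blast
  have n: "int n = int (n div p) * int p"
    using p by (metis dvd_div_mult_self in_prime_factors_imp_dvd of_nat_mult)
  let ?g = "\<lambda>j. of_int (Jacobi j n) * root_exp n (j * k)"
  have "?s = (\<Sum>j\<in>{0..<int n}. ?g (a * j))"
  proof (rule sum_mod_mult[symmetric])
    show "?g (x mod int n) = ?g x" for x
      using n_gt_1 root_exp_cong[of n "x mod int n * k" "x * k"]
      by (simp add: Jacobi_mod cong_def mod_mult_left_eq)
  qed (use n_gt_1 a coprime_if_Jacobi_neq_0 in auto)
  also have "\<dots> = (\<Sum>j\<in>{0..<int n}. - ?g j)"
  proof (rule sum.cong[OF refl])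
    fix j
    have "int n dvd (a - 1) * k"
      unfolding n using a(2) p(2) by (intro mult_dvd_mono) (auto simp: cong_iff_dvd_diff)
    then have "int n dvd (a - 1) * k * j" by (rule dvd_mult2)
    also have "(a - 1) * k * j = a * j * k - j * k" by (simp add: algebra_simps)
    finally have "root_exp n (a * j * k) = root_exp n (j * k)"
      using n_gt_1 by (intro root_exp_cong) (auto simp: cong_iff_dvd_diff)
    then show "?g (a * j) = - ?g j"
      by (simp add: Jacobi_facts(2) a(1))
  qed
  also have "\<dots> = - ?s" by (simp add: sum_negf)
  finally show ?thesis using True by simp
qed

text \<open>Apply Parseval to the sequence of symbols, whose transform is known from
  \<open>sum_Jacobi_root_exp\<close>. Both sides contain the number of units as a factor, which
  cancels because 1 is a unit.\<close>

lemma norm_Jacobi_Gauss_sum: "(cmod Jacobi_Gauss_sum)\<^sup>2 = real n"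
proof -
  let ?I = "{0..<int n}"
  let ?S = "\<Sum>j\<in>?I. (real_of_int (Jacobi j n))\<^sup>2"
  have "?S * (cmod Jacobi_Gauss_sum)\<^sup>2
      = (\<Sum>k\<in>?I. (cmod (\<Sum>j\<in>?I. of_int (Jacobi j n) * root_exp n (j * k)))\<^sup>2)"
    by (simp add: sum_Jacobi_root_exp norm_mult power_mult_distrib sum_distrib_right)
  also have "\<dots> = real n * (\<Sum>j\<in>?I. (cmod (of_int (Jacobi j n)))\<^sup>2)"
    by (rule parseval_root_exp) (use n_gt_1 in simp)
  also have "\<dots> = real n * ?S" by simp
  finally have "?S * (cmod Jacobi_Gauss_sum)\<^sup>2 = ?S * real n" by simp
  moreover have "(real_of_int (Jacobi 1 n))\<^sup>2 \<le> ?S"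
    by (rule member_le_sum) (use n_gt_1 in auto)
  then have "?S \<noteq> 0" by (auto simp: Jacobi_1)
  ultimately show ?thesis by simp
qed

lemma cnj_Jacobi_Gauss_sum: "cnj Jacobi_Gauss_sum = of_int (Jacobi (-1) n) * Jacobi_Gauss_sum"
proof -
  have "cnj Jacobi_Gauss_sum = (\<Sum>j\<in>{0..<int n}. of_int (Jacobi j n) * root_exp n (j * (- 1)))"
    by (simp add: Jacobi_Gauss_sum_def cnj_root_exp)
  then show ?thesis by (simp only: sum_Jacobi_root_exp)
qed

end

subsection \<open>Linearly weighted exponential sums\<close>

text \<open>Replacing \<open>j\<close> by \<open>j + 1\<close> multiplies the sum by
  \<open>root_exp n m\<close>, up to a complete exponential sum, which vanishes, and the wrap-around
  from \<open>n - 1\<close> to 0, which contributes \<open>n\<close>.\<close>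

lemma sum_linear_root_exp:
  assumes "n > 0" "\<not> int n dvd m"
  shows "(\<Sum>j\<in>{0..<int n}. of_int j * root_exp n (m * j)) * (root_exp n m - 1) = of_nat n"
proof -
  let ?I = "{0..<int n}"
  let ?g = "\<lambda>x. of_int (x mod int n) * root_exp n (m * x)"
  let ?S = "\<Sum>j\<in>?I. of_int j * root_exp n (m * j)"
  have per: "?g (x mod int n) = ?g x" for x
    using assms root_exp_cong[of n "m * (x mod int n)" "m * x"]
    by (simp add: cong_def mod_mult_right_eq)
  have "?S = (\<Sum>x\<in>?I. ?g x)" by (rule sum.cong) auto
  also have "\<dots> = (\<Sum>x\<in>?I. ?g (x + 1))"
    using assms per by (intro sum_mod_shift[symmetric]) auto
  also have "\<dots> = (\<Sum>x\<in>?I. (of_int x * root_exp n (m * x) + root_exp n (m * x)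
      - (if x = int n - 1 then of_nat n * root_exp n (m * x) else 0)) * root_exp n m)"
  proof (rule sum.cong[OF refl])
    fix x assume x: "x \<in> ?I"
    have "(x + 1) mod int n = (if x = int n - 1 then 0 else x + 1)"
      using x by auto
    then show "?g (x + 1) = (of_int x * root_exp n (m * x) + root_exp n (m * x)
      - (if x = int n - 1 then of_nat n * root_exp n (m * x) else 0)) * root_exp n m"
    proof (cases "x = int n - 1")
      case True
      then have *: "complex_of_nat n = of_int x + 1" "(x + 1) mod int n = 0" by auto
      show ?thesis unfolding * if_P[OF True] by (simp add: algebra_simps)
    next
      case False
      then show ?thesis using \<open>(x + 1) mod int n = _\<close>
        by (simp add: root_exp_add algebra_simps)
    qed
  qed
  also have "\<dots> = (?S + (\<Sum>x\<in>?I. root_exp n (m * x))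
      - of_nat n * root_exp n (m * (int n - 1))) * root_exp n m"
    using assms by (simp add: sum_distrib_right[symmetric] sum.distrib sum_subtractf)
  also have "(\<Sum>x\<in>?I. root_exp n (m * x)) = 0"
    using assms by (simp add: sum_root_exp)
  also have "(?S + 0 - of_nat n * root_exp n (m * (int n - 1))) * root_exp n m
      = ?S * root_exp n m - of_nat n * root_exp n (m * int n)"
    using root_exp_add[of n "m * (int n - 1)" m] by (simp add: algebra_simps)
  also have "root_exp n (m * int n) = 1"
    using assms by (simp add: root_exp_eq_1_iff)
  finally show ?thesis by (simp add: algebra_simps)
qed

text \<open>Jordan's inequality: a concave function lies above its chord.\<close>

lemma sin_ge_two_pi:
  assumes "0 \<le> x" "x \<le> pi / 2"
  shows "sin x \<ge> 2 / pi * x"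
proof -
  have "concave_on {0..pi/2} sin"
  proof (rule f''_le0_imp_concave)
    show "- sin x \<le> 0" if "x \<in> {0..pi/2}" for x
      using that sin_ge_zero[of x] by auto
  qed (auto intro!: derivative_eq_intros)
  from concave_onD_Icc'[OF this, of x] show ?thesis
    using assms by simp
qed

lemma norm_root_exp_minus_1_ge:
  assumes "0 < s" "2 * s \<le> int n"
  shows "cmod (root_exp n s - 1) \<ge> 4 * of_int s / real n"
proof -
  have n: "real n > 0" using assms by simp
  have s2: "2 * real_of_int s \<le> real n" using assms by linarith
  have "cmod (root_exp n s - 1) = 2 * \<bar>sin (pi * of_int s / real n)\<bar>"
    using dist_exp_i_1[of "2 * pi * of_int s / real n"]
    by (simp add: root_exp_def cis_conv_exp)
  moreover have "sin (pi * of_int s / real n) \<ge> 2 / pi * (pi * of_int s / real n)"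
  proof (rule sin_ge_two_pi)
    show "pi * of_int s / real n \<le> pi / 2"
      using n s2 by (simp add: field_simps)
  qed (use assms in auto)
  ultimately show ?thesis by simp
qed

lemma norm_root_exp_minus_1_reflect:
  assumes "n > 0"
  shows "cmod (root_exp n (int n - s) - 1) = cmod (root_exp n s - 1)"
proof -
  have "root_exp n (int n - s) = root_exp n (- s)"
    using assms by (intro root_exp_cong) (auto simp: cong_iff_dvd_diff)
  then have "root_exp n (int n - s) - 1 = cnj (root_exp n s - 1)"
    by (simp add: cnj_root_exp)
  then show ?thesis by (metis complex_mod_cnj)
qed

text \<open>The modulus of \<open>root_exp n s - 1\<close> is at least 4/n times the smaller of
  \<open>s\<close> and \<open>n - s\<close>. Adding the two reciprocals, instead of taking the
  larger, gives a bound that is easily summed over \<open>s\<close>.\<close>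

lemma norm_sum_linear_root_exp_le:
  assumes "0 < s" "s < int n"
  shows "cmod (\<Sum>j\<in>{0..<int n}. of_int j * root_exp n (s * j))
    \<le> (real n)\<^sup>2 / 4 * (1 / of_int s + 1 / (real n - of_int s))"
proof -
  have pos: "n > 0" "real_of_int s > 0" "real_of_int s < real n" using assms by linarith+
  have ndvd: "\<not> int n dvd s" using assms by (simp add: zdvd_not_zless)
  let ?S = "\<Sum>j\<in>{0..<int n}. of_int j * root_exp n (s * j)"
  define d where "d = cmod (root_exp n s - 1)"
  have "cmod (?S * (root_exp n s - 1)) = real n"
    by (simp add: sum_linear_root_exp[OF pos(1) ndvd])
  then have Sd: "cmod ?S * d = real n" by (simp add: norm_mult d_def)
  have main: "cmod ?S \<le> (real n)\<^sup>2 / 4 * (1 / t)" if "d \<ge> 4 * t / real n" "t > 0" for t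
  proof -
    have "cmod ?S * (4 * t / real n) \<le> cmod ?S * d"
      by (intro mult_left_mono that norm_ge_zero)
    then have "cmod ?S * (4 * t / real n) \<le> real n" unfolding Sd .
    then have "cmod ?S \<le> real n / (4 * t / real n)"
      using that pos by (subst pos_le_divide_eq) auto
    then show ?thesis by (simp add: power2_eq_square)
  qed
  show ?thesis
  proof (cases "2 * s \<le> int n")
    case True
    then have "d \<ge> 4 * of_int s / real n"
      unfolding d_def using assms by (intro norm_root_exp_minus_1_ge) auto
    from main[OF this] have "cmod ?S \<le> (real n)\<^sup>2 / 4 * (1 / of_int s)" using pos by simp
    also have "\<dots> \<le> (real n)\<^sup>2 / 4 * (1 / of_int s + 1 / (real n - of_int s))"
      using pos by (intro mult_left_mono) auto
    finally show ?thesis .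
  next
    case False
    then have "d \<ge> 4 * of_int (int n - s) / real n"
      using norm_root_exp_minus_1_ge[of "int n - s" n] norm_root_exp_minus_1_reflect[OF pos(1), of s] assms
      by (simp add: d_def)
    then have "d \<ge> 4 * (real n - of_int s) / real n" by simp
    from main[OF this] have "cmod ?S \<le> (real n)\<^sup>2 / 4 * (1 / (real n - of_int s))" using pos by simp
    also have "\<dots> \<le> (real n)\<^sup>2 / 4 * (1 / of_int s + 1 / (real n - of_int s))"
      using pos by (intro mult_left_mono) auto
    finally show ?thesis .
  qed
qed

text \<open>The sequence \<open>harm m - ln m\<close> decreases from its value 1 at
  \<open>m = 1\<close>.\<close>

lemma harm_le_1_plus_ln:
  assumes "n > 0"
  shows "harm n \<le> 1 + ln (real n)"
proof -
  obtain m where m: "n = Suc m" using assms by (cases n) auto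
  have "harm (Suc m) - ln (real (Suc m)) \<le> harm (Suc 0) - ln (real (Suc 0))"
    using decseqD[OF decseq_harm_diff_ln, of 0 m] by simp
  then show ?thesis by (simp add: m harm_def)
qed

lemma ln_ge_1: "x \<ge> 3 \<Longrightarrow> ln x \<ge> (1::real)"
  using exp_le by (subst ln_ge_iff) auto

lemma sum_norm_sum_linear_root_exp_le:
  assumes "n \<ge> 3"
  shows "(\<Sum>s\<in>{0<..<int n}. cmod (\<Sum>j\<in>{0..<int n}. of_int j * root_exp n (s * j)))
    \<le> (real n)\<^sup>2 * ln (real n)"
proof -
  have "(\<Sum>s\<in>{0<..<int n}. cmod (\<Sum>j\<in>{0..<int n}. of_int j * root_exp n (s * j)))
    \<le> (\<Sum>s\<in>{0<..<int n}. (real n)\<^sup>2 / 4 * (1 / of_int s + 1 / (real n - of_int s)))"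
    by (intro sum_mono norm_sum_linear_root_exp_le) auto
  also have "\<dots> = (real n)\<^sup>2 / 4 * ((\<Sum>s\<in>{0<..<int n}. 1 / of_int s)
      + (\<Sum>s\<in>{0<..<int n}. 1 / (real n - of_int s)))"
    by (simp only: sum_distrib_left sum.distrib distrib_left)
  also have "(\<Sum>s\<in>{0<..<int n}. 1 / (real n - of_int s)) = (\<Sum>s\<in>{0<..<int n}. 1 / of_int s)"
    by (rule sum.reindex_bij_witness[of _ "\<lambda>s. int n - s" "\<lambda>s. int n - s"]) auto
  also have "(\<Sum>s\<in>{0<..<int n}. 1 / real_of_int s) = harm (n - 1)"
    unfolding harm_def
    by (rule sum.reindex_bij_witness[of _ int nat]) (auto simp: field_simps)
  \<comment> \<open>The two harmonic sums are at most \<open>2 + 2 * ln n\<close>, and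
    \<open>ln n\<close> is at least 1 for \<open>n \<ge> 3\<close>; this absorbs the
    constant.\<close>
  also have "(real n)\<^sup>2 / 4 * (harm (n - 1) + harm (n - 1)) \<le> (real n)\<^sup>2 / 4 * (4 * ln (real n))"
  proof (rule mult_left_mono)
    have "harm (n - 1) \<le> (harm n :: real)" by (rule harm_mono) simp
    moreover have "harm n \<le> 1 + ln (real n)" using assms by (intro harm_le_1_plus_ln) auto
    moreover have "1 \<le> ln (real n)" using assms by (intro ln_ge_1) auto
    ultimately show "harm (n - 1) + harm (n - 1) \<le> 4 * ln (real n)" by linarith
  qed simp
  finally show ?thesis by simp
qed

subsection \<open>Mean values of trigonometric sums\<close>

lemma has_integral_cis:
  "((\<lambda>\<theta>. cis (of_int v * \<theta>)) has_integral (if v = 0 then of_real (2 * pi) else 0)) {0..2*pi}"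
proof (cases "v = 0")
  case True
  then show ?thesis using has_integral_const_real[of "1::complex" 0 "2 * pi"] by (simp add: scaleR_conv_of_real)
next
  case False
  let ?F = "\<lambda>\<theta>. cis (of_int v * \<theta>) / (\<i> * of_int v)"
  have "(?F has_vector_derivative cis (of_int v * \<theta>)) (at \<theta> within {0..2*pi})" for \<theta> :: real
  proof -
    have "((\<lambda>z. exp (\<i> * (of_int v * z)) / (\<i> * of_int v)) has_field_derivative
        exp (\<i> * (of_int v * of_real \<theta>))) (at (of_real \<theta>))"
      using False by (auto intro!: derivative_eq_intros simp: mult_ac)
    from has_vector_derivative_real_field[OF this] show ?thesis
      by (simp add: cis_conv_exp)
  qed
  then have "((\<lambda>\<theta>. cis (of_int v * \<theta>)) has_integral ?F (2 * pi) - ?F 0) {0..2*pi}"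
    by (intro fundamental_theorem_of_calculus) auto
  moreover have "cis (of_int v * (2 * pi)) = 1"
    using cis_multiple_2pi[of "of_int v"] by (simp add: mult_ac)
  ultimately show ?thesis using False by simp
qed

text \<open>Expanding the square, only the diagonal survives integration. It serves
  \<open>lnorm 2\<close> with the coefficients \<open>a j\<close>, and \<open>lnorm 4\<close> with
  the autocorrelations \<open>C v\<close>, which are the coefficients of the squared
  modulus.\<close>

lemma integral_norm_trig_sum_square:
  fixes c :: "int \<Rightarrow> complex"
  assumes "finite V"
  shows "integral {0..2*pi} (\<lambda>\<theta>. (cmod (\<Sum>v\<in>V. c v * cis (of_int v * \<theta>)))\<^sup>2)
    = 2 * pi * (\<Sum>v\<in>V. (cmod (c v))\<^sup>2)"
proof -
  have eq: "complex_of_real ((cmod (\<Sum>v\<in>V. c v * cis (of_int v * \<theta>)))\<^sup>2)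
      = (\<Sum>v\<in>V. \<Sum>w\<in>V. c v * cnj (c w) * cis (of_int (v - w) * \<theta>))" for \<theta>
    unfolding complex_norm_square cnj_sum sum_product
    by (intro sum.cong refl) (simp add: cis_cnj cis_mult algebra_simps)
  have "((\<lambda>\<theta>. \<Sum>v\<in>V. \<Sum>w\<in>V. c v * cnj (c w) * cis (of_int (v - w) * \<theta>))
      has_integral (\<Sum>v\<in>V. \<Sum>w\<in>V. c v * cnj (c w) * (if v - w = 0 then of_real (2 * pi) else 0))) {0..2*pi}"
    by (intro has_integral_sum has_integral_mult_right has_integral_cis assms)
  also have "(\<Sum>v\<in>V. \<Sum>w\<in>V. c v * cnj (c w) * (if v - w = 0 then of_real (2 * pi) else 0))
      = (\<Sum>v\<in>V. \<Sum>w\<in>V. if w = v then of_real (2 * pi) * (c v * cnj (c w)) else 0)"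
    by (intro sum.cong refl) auto
  also have "\<dots> = (\<Sum>v\<in>V. of_real (2 * pi) * (c v * cnj (c v)))"
    using assms by simp
  also have "\<dots> = complex_of_real (2 * pi * (\<Sum>v\<in>V. (cmod (c v))\<^sup>2))"
    unfolding of_real_mult of_real_sum sum_distrib_left complex_norm_square ..
  finally have "((\<lambda>\<theta>. complex_of_real ((cmod (\<Sum>v\<in>V. c v * cis (of_int v * \<theta>)))\<^sup>2))
      has_integral complex_of_real (2 * pi * (\<Sum>v\<in>V. (cmod (c v))\<^sup>2))) {0..2*pi}"
    unfolding eq .
  from has_integral_linear[OF this bounded_linear_Re] show ?thesis
    by (intro integral_unique) (simp add: o_def del: of_real_sum)
qed

subsection \<open>Correlations of a shifted real primitive character\<close>

text \<open>Here \<open>gauss_sum\<close>, required at units and non-units alike, expresses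
  primitivity, and \<open>\<epsilon>\<close> is the value of the character at -1.\<close>

locale real_primitive_character =
  fixes n :: nat and chi :: "int \<Rightarrow> real" and \<epsilon> :: real and G :: complex
  assumes n_ge_3: "n \<ge> 3"
    and chi_mod: "\<And>x. chi (x mod int n) = chi x"
    and chi_values: "\<And>x. chi x \<in> {-1, 0, 1}"
    and chi_minus: "\<And>x. chi (- x) = \<epsilon> * chi x"
    and eps_square: "\<epsilon>\<^sup>2 = 1"
    and gauss_sum: "\<And>k. (\<Sum>j\<in>{0..<int n}. of_real (chi j) * root_exp n (j * k)) = of_real (chi k) * G"
    and norm_gauss_sum: "(cmod G)\<^sup>2 = real n"
    and cnj_gauss_sum: "cnj G = of_real \<epsilon> * G"
begin

abbreviation I :: "int set" where "I \<equiv> {0..<int n}"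

definition zeros :: "int set" where "zeros = {k \<in> I. chi k = 0}"

lemma n_pos: "n > 0" "int n > 0"
  using n_ge_3 by auto

lemma chi_cong: "[x = y] (mod int n) \<Longrightarrow> chi x = chi y"
  by (metis chi_mod cong_def)

lemma chi_square: "(chi x)\<^sup>2 = (if chi x = 0 then 0 else 1)"
  using chi_values[of x] by auto

lemma sum_one_minus_chi_square: "(\<Sum>k\<in>I. 1 - (chi k)\<^sup>2) = real (card zeros)"
proof -
  have "(\<Sum>k\<in>I. 1 - (chi k)\<^sup>2) = (\<Sum>k\<in>I. if chi k = 0 then 1 else 0)"
    by (rule sum.cong) (auto simp: chi_square)
  then show ?thesis by (simp add: zeros_def sum.If_cases Int_def)
qed

lemma sum_chi_square: "(\<Sum>k\<in>I. (chi k)\<^sup>2) = real n - real (card zeros)"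
  using sum_one_minus_chi_square by (simp add: sum_subtractf)

section \<open>The shifted character, its transforms and its correlations\<close>

context
  fixes R :: int
begin

definition a :: "int \<Rightarrow> real" where "a j = chi (j + R)"

definition E :: "int \<Rightarrow> complex" where
  "E k = (\<Sum>j\<in>I. of_real (a j) * root_exp n (j * k))"

definition D :: "int \<Rightarrow> complex" where
  "D k = (\<Sum>j\<in>I. of_real (of_int j * a j) * root_exp n (j * k))"

definition C :: "int \<Rightarrow> real" where
  "C v = (\<Sum>j\<in>I. \<Sum>l\<in>I. if j - l = v then a j * a l else 0)"

definition P :: "int \<Rightarrow> real" where
  "P u = (\<Sum>j\<in>I. \<Sum>l\<in>I. if (j - l) mod int n = u then a j * a l else 0)"

definition L :: "int \<Rightarrow> real" where
  "L u = (\<Sum>j\<in>I. \<Sum>l\<in>I. if (j - l) mod int n = u then of_int (j - l) * (a j * a l) else 0)"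

lemma abs_a_le: "\<bar>a j\<bar> \<le> 1"
  using chi_values[of "j + R"] by (auto simp: a_def)

lemma sum_a_square: "(\<Sum>j\<in>I. (a j)\<^sup>2) = real n - real (card zeros)"
  unfolding a_def sum_chi_square[symmetric]
  by (rule sum_mod_shift) (use n_pos in \<open>auto simp: chi_mod\<close>)

lemma sum_one_minus_a_square: "(\<Sum>j\<in>I. 1 - (a j)\<^sup>2) = real (card zeros)"
  using sum_a_square by (simp add: sum_subtractf)

lemma E_eq: "E k = of_real (chi k) * G * root_exp n (- (R * k))"
proof -
  have "E k = (\<Sum>j\<in>I. of_real (chi (j + R)) * root_exp n ((j + R) * k)) * root_exp n (- (R * k))"
    unfolding E_def a_def sum_distrib_right
    by (intro sum.cong refl)
      (simp add: mult.assoc distrib_right root_exp_add[symmetric])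
  also have "(\<Sum>j\<in>I. of_real (chi (j + R)) * root_exp n ((j + R) * k))
      = (\<Sum>j\<in>I. of_real (chi j) * root_exp n (j * k))"
  proof (rule sum_mod_shift)
    show "of_real (chi (x mod int n)) * root_exp n (x mod int n * k) = of_real (chi x) * root_exp n (x * k)" for x
      using root_exp_cong[of n "x mod int n * k" "x * k"] n_pos
      by (simp add: chi_mod cong_def mod_mult_left_eq)
  qed (use n_pos in auto)
  finally show ?thesis by (simp add: gauss_sum)
qed

lemma norm_E_square: "(cmod (E k))\<^sup>2 = real n * (chi k)\<^sup>2"
  by (simp add: E_eq norm_mult power_mult_distrib norm_gauss_sum)

text \<open>From \<open>cnj G = \<epsilon> * G\<close> the square of \<open>cnj G\<close> is
  \<open>\<epsilon> * n\<close>, so the phase of \<open>E k\<close> is known and not only its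
  modulus. This is what makes the mixed term in the mean square of \<open>L\<close> a twisted second
  moment of \<open>D\<close>.\<close>

lemma cnj_E_square: "(cnj (E k))\<^sup>2 = of_real (\<epsilon> * real n * (chi k)\<^sup>2) * root_exp n (2 * R * k)"
proof -
  have "(cnj G)\<^sup>2 = of_real \<epsilon> * (G * cnj G)"
    by (simp add: cnj_gauss_sum power2_eq_square)
  also have "G * cnj G = of_real (real n)"
    by (simp only: complex_norm_square[symmetric] norm_gauss_sum)
  finally have G: "(cnj G)\<^sup>2 = of_real (\<epsilon> * real n)" by simp
  have e: "(root_exp n (R * k))\<^sup>2 = root_exp n (2 * R * k)"
    by (simp add: power2_eq_square root_exp_add[symmetric] algebra_simps)
  show ?thesis
    by (simp add: E_eq power_mult_distrib G e cnj_root_exp)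
qed

lemma C_0: "C 0 = real n - real (card zeros)"
proof -
  have "C 0 = (\<Sum>j\<in>I. \<Sum>l\<in>I. if l = j then a j * a l else 0)"
    unfolding C_def by (intro sum.cong refl if_cong) auto
  then show ?thesis by (simp add: sum_a_square[symmetric] power2_eq_square)
qed

lemma C_minus: "C (- v) = C v"
  unfolding C_def
  by (subst sum.swap) (intro sum.cong refl if_cong, auto)

lemma P_0: "P 0 = real n - real (card zeros)"
proof -
  have "P 0 = (\<Sum>j\<in>I. \<Sum>l\<in>I. if l = j then a j * a l else 0)"
    unfolding P_def
  proof (intro sum.cong refl if_cong)
    fix j l assume "j \<in> I" "l \<in> I"
    then show "((j - l) mod int n = 0) = (l = j)"
      by (auto simp flip: cong_iff_dvd_diff simp: mod_eq_0_iff_dvd cong_def)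
  qed
  then show ?thesis by (simp add: sum_a_square[symmetric] power2_eq_square)
qed

text \<open>The combined weight \<open>(j - l) + (n - u)\<close> equals \<open>n\<close> on pairs
  with difference \<open>u\<close> and 0 on pairs with difference \<open>u - n\<close>, and these
  are the only differences in the residue class of \<open>u\<close>.\<close>

lemma n_times_C:
  assumes "0 < u" "u < int n"
  shows "real n * C u = L u + (real n - of_int u) * P u"
proof -
  have mod_iff: "(j - l) mod int n = u \<longleftrightarrow> j - l = u \<or> j - l = u - int n" if "j \<in> I" "l \<in> I" for j l
  proof (cases "j \<ge> l")
    case True
    then have "(j - l) mod int n = j - l" using that by simp
    then show ?thesis using that True assms by auto
  next
    case False
    then have "(j - l) mod int n = (j - l + int n) mod int n" by simp
    also have "\<dots> = j - l + int n" using that False by (intro mod_pos_pos_trivial) auto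
    finally show ?thesis using that False assms by auto
  qed
  have "L u + (real n - of_int u) * P u = (\<Sum>j\<in>I. \<Sum>l\<in>I. real n * (if j - l = u then a j * a l else 0))"
    unfolding L_def P_def sum_distrib_left sum.distrib[symmetric]
  proof (intro sum.cong refl)
    fix j l assume jl: "j \<in> I" "l \<in> I"
    show "(if (j - l) mod int n = u then of_int (j - l) * (a j * a l) else 0)
        + (real n - of_int u) * (if (j - l) mod int n = u then a j * a l else 0)
      = real n * (if j - l = u then a j * a l else 0)"
    proof (cases "j - l = u - int n")
      case True
      then have e: "real_of_int (j - l) = of_int u - real n" "j - l \<noteq> u"
        using n_pos by auto
      show ?thesis
        unfolding mod_iff[OF jl] e(1) using e(2) True by (simp add: algebra_simps)
    next
      case False
      then show ?thesis unfolding mod_iff[OF jl] by (auto simp: algebra_simps)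
    qed
  qed
  also have "\<dots> = real n * C u" by (simp add: C_def sum_distrib_left)
  finally show ?thesis ..
qed

text \<open>The transform of a cyclic correlation, with a general weight \<open>w\<close> so that
  one rearrangement serves \<open>P\<close> and \<open>L\<close>.\<close>

lemma sum_residue_classes:
  "(\<Sum>u\<in>I. (\<Sum>j\<in>I. \<Sum>l\<in>I. if (j - l) mod int n = u then w j l else 0) * root_exp n (u * k))
    = (\<Sum>j\<in>I. \<Sum>l\<in>I. w j l * root_exp n (j * k) * cnj (root_exp n (l * k)))"
proof -
  have "(\<Sum>u\<in>I. (\<Sum>j\<in>I. \<Sum>l\<in>I. if (j - l) mod int n = u then w j l else 0) * root_exp n (u * k))
    = (\<Sum>u\<in>I. \<Sum>j\<in>I. \<Sum>l\<in>I. if (j - l) mod int n = u then w j l * root_exp n (u * k) else 0)"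
    unfolding sum_distrib_right by (intro sum.cong refl) auto
  also have "\<dots> = (\<Sum>j\<in>I. \<Sum>u\<in>I. \<Sum>l\<in>I. if (j - l) mod int n = u then w j l * root_exp n (u * k) else 0)"
    by (rule sum.swap)
  also have "\<dots> = (\<Sum>j\<in>I. \<Sum>l\<in>I. \<Sum>u\<in>I. if (j - l) mod int n = u then w j l * root_exp n (u * k) else 0)"
    by (intro sum.cong refl sum.swap)
  also have "\<dots> = (\<Sum>j\<in>I. \<Sum>l\<in>I. w j l * root_exp n (j * k) * cnj (root_exp n (l * k)))"
  proof (intro sum.cong refl)
    fix j l assume "j \<in> I" "l \<in> I"
    have "root_exp n ((j - l) mod int n * k) = root_exp n ((j + - l) * k)"
      using n_pos by (intro root_exp_cong) (auto simp: cong_def mod_mult_left_eq)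
    also have "\<dots> = root_exp n (j * k) * cnj (root_exp n (l * k))"
      by (simp only: distrib_right root_exp_add cnj_root_exp minus_mult_left)
    finally show "(\<Sum>u\<in>I. if (j - l) mod int n = u then w j l * root_exp n (u * k) else 0)
       = w j l * root_exp n (j * k) * cnj (root_exp n (l * k))"
      using n_pos by simp
  qed
  finally show ?thesis .
qed

lemma dft_P: "(\<Sum>u\<in>I. of_real (P u) * root_exp n (u * k)) = of_real ((cmod (E k))\<^sup>2)"
proof -
  have "(\<Sum>u\<in>I. of_real (P u) * root_exp n (u * k))
    = (\<Sum>u\<in>I. (\<Sum>j\<in>I. \<Sum>l\<in>I. if (j - l) mod int n = u then of_real (a j * a l) else 0) * root_exp n (u * k))"
    unfolding P_def of_real_sum by (intro sum.cong refl arg_cong2[where f = "(*)"]) auto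
  also have "\<dots> = E k * cnj (E k)"
    unfolding sum_residue_classes unfolding E_def cnj_sum sum_product
    by (intro sum.cong refl) simp
  finally show ?thesis by (simp only: complex_norm_square)
qed

lemma dft_L: "(\<Sum>u\<in>I. of_real (L u) * root_exp n (u * k)) = D k * cnj (E k) - E k * cnj (D k)"
proof -
  have "(\<Sum>u\<in>I. of_real (L u) * root_exp n (u * k))
    = (\<Sum>u\<in>I. (\<Sum>j\<in>I. \<Sum>l\<in>I. if (j - l) mod int n = u then of_real (of_int (j - l) * (a j * a l)) else 0)
        * root_exp n (u * k))"
    unfolding L_def of_real_sum by (intro sum.cong refl arg_cong2[where f = "(*)"]) auto
  also have "\<dots> = D k * cnj (E k) - E k * cnj (D k)"
    unfolding sum_residue_classes unfolding E_def D_def cnj_sum sum_product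
    unfolding sum_subtractf[symmetric]
    by (intro sum.cong refl) (simp add: algebra_simps)
  finally show ?thesis .
qed

text \<open>The transform of \<open>P\<close> is \<open>n\<close> at units and 0 elsewhere, so with
  z zeros Parseval gives n(n - z) for the sum over all \<open>u\<close>. Removing the term (n - z)^2
  at \<open>u = 0\<close> leaves z(n - z).\<close>

lemma sum_P_square:
  "(\<Sum>u\<in>{0<..<int n}. (P u)\<^sup>2) = real (card zeros) * (real n - real (card zeros))"
proof -
  have "real n * (\<Sum>u\<in>I. (cmod (of_real (P u)))\<^sup>2) = (\<Sum>k\<in>I. (cmod (of_real ((cmod (E k))\<^sup>2)))\<^sup>2)"
    unfolding dft_P[symmetric] by (rule parseval_root_exp[OF n_pos(1), symmetric])
  also have "\<dots> = (\<Sum>k\<in>I. (real n)\<^sup>2 * (chi k)\<^sup>2)"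
    unfolding norm_E_square by (intro sum.cong refl) (auto simp: chi_square)
  also have "\<dots> = (real n)\<^sup>2 * (real n - real (card zeros))"
    by (simp add: sum_distrib_left[symmetric] sum_chi_square)
  finally have "real n * (\<Sum>u\<in>I. (P u)\<^sup>2) = real n * (real n * (real n - real (card zeros)))"
    by (simp add: power2_eq_square)
  then have "(\<Sum>u\<in>I. (P u)\<^sup>2) = real n * (real n - real (card zeros))"
    using n_pos by simp
  moreover have "I = insert 0 {0<..<int n}" using n_pos by auto
  ultimately have "(P 0)\<^sup>2 + (\<Sum>u\<in>{0<..<int n}. (P u)\<^sup>2) = real n * (real n - real (card zeros))"
    by simp
  then show ?thesis by (simp add: P_0 power2_eq_square algebra_simps)
qed

section \<open>The mean square of the weighted correlation \<open>L\<close>\<close>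

definition reflect :: "int \<Rightarrow> int" where "reflect j = (- 2 * R - j) mod int n"

lemma reflect_mem: "reflect j \<in> I"
  using n_pos by (simp add: reflect_def)

lemma sum_norm_D_square: "(\<Sum>k\<in>I. (cmod (D k))\<^sup>2) = real n * (\<Sum>j\<in>I. (a j)\<^sup>2 * of_int (j * j))"
  unfolding D_def parseval_root_exp[OF n_pos(1)]
  by (simp add: norm_mult power_mult_distrib power2_eq_square mult_ac)

text \<open>The symmetry of the character enters here: \<open>j + l = -2R\<close> modulo \<open>n\<close> makes
  \<open>l + R\<close> and \<open>j + R\<close> opposite residues.\<close>

lemma sum_D_square_root_exp:
  "(\<Sum>k\<in>I. (D k)\<^sup>2 * root_exp n (2 * R * k))
    = of_real (\<epsilon> * real n * (\<Sum>j\<in>I. (a j)\<^sup>2 * of_int (j * reflect j)))"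
proof -
  have "(\<Sum>k\<in>I. (D k)\<^sup>2 * root_exp n (2 * R * k))
    = of_nat n * (\<Sum>j\<in>I. \<Sum>l\<in>I. if int n dvd j + l + 2 * R
        then of_real (of_int j * a j) * of_real (of_int l * a l) else 0)"
    unfolding D_def power2_eq_square by (rule sum_mult_root_exp[OF n_pos(1)])
  also have "(\<Sum>j\<in>I. \<Sum>l\<in>I. if int n dvd j + l + 2 * R
        then of_real (of_int j * a j) * of_real (of_int l * a l) else 0)
     = (\<Sum>j\<in>I. \<Sum>l\<in>I. if l = reflect j
        then complex_of_real (\<epsilon> * ((a j)\<^sup>2 * of_int (j * l))) else 0)"
  proof (intro sum.cong refl)
    fix j l assume "j \<in> I" "l \<in> I"
    have dvd_iff: "int n dvd j + l + 2 * R \<longleftrightarrow> l = reflect j"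
    proof -
      have "int n dvd j + l + 2 * R \<longleftrightarrow> [l = - 2 * R - j] (mod int n)"
        by (simp add: cong_iff_dvd_diff algebra_simps)
      also have "\<dots> \<longleftrightarrow> l = reflect j"
        using \<open>l \<in> I\<close> by (simp add: cong_def reflect_def)
      finally show ?thesis .
    qed
    moreover have "a l = \<epsilon> * a j" if "int n dvd j + l + 2 * R"
    proof -
      have "[l + R = - (j + R)] (mod int n)"
        using that by (simp add: cong_iff_dvd_diff algebra_simps)
      then show ?thesis unfolding a_def chi_minus[symmetric] by (rule chi_cong)
    qed
    ultimately show "(if int n dvd j + l + 2 * R
        then of_real (of_int j * a j) * of_real (of_int l * a l) else 0)
      = (if l = reflect j then complex_of_real (\<epsilon> * ((a j)\<^sup>2 * of_int (j * l))) else 0)"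
      by (simp add: power2_eq_square)
  qed
  also have "\<dots> = (\<Sum>j\<in>I. complex_of_real (\<epsilon> * ((a j)\<^sup>2 * of_int (j * reflect j))))"
    using reflect_mem by (intro sum.cong refl) simp
  finally show ?thesis by (simp add: sum_distrib_left mult_ac)
qed

text \<open>Both sides are four times the square of \<open>Im z\<close>. Using the square of
  \<open>z\<close> on the right brings in the square of \<open>cnj (E k)\<close>, which is
  explicit.\<close>

lemma norm_diff_cnj_square: "(cmod (z - cnj z))\<^sup>2 = 2 * (cmod z)\<^sup>2 - 2 * Re (z\<^sup>2)"
  unfolding cmod_power2 by (simp add: power2_eq_square algebra_simps)

text \<open>Parseval, with \<open>norm_diff_cnj_square\<close> at
  \<open>z = D k * cnj (E k)\<close>. All dependence on \<open>E\<close> reduces to the factor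
  \<open>n\<close>, the sign \<open>\<epsilon>\<close>, a phase and the square of
  \<open>chi k\<close>; the last is 1 except at the zeros.\<close>

lemma n_sum_L_square:
  "real n * (\<Sum>u\<in>I. (L u)\<^sup>2)
    = 2 * real n * (\<Sum>k\<in>I. (chi k)\<^sup>2 * ((cmod (D k))\<^sup>2 - \<epsilon> * Re ((D k)\<^sup>2 * root_exp n (2 * R * k))))"
proof -
  have "real n * (\<Sum>u\<in>I. (L u)\<^sup>2) = real n * (\<Sum>u\<in>I. (cmod (of_real (L u)))\<^sup>2)" by simp
  also have "\<dots> = (\<Sum>k\<in>I. (cmod (D k * cnj (E k) - E k * cnj (D k)))\<^sup>2)"
    unfolding dft_L[symmetric] by (rule parseval_root_exp[OF n_pos(1), symmetric])
  also have "\<dots> = (\<Sum>k\<in>I. 2 * real n * ((chi k)\<^sup>2 * ((cmod (D k))\<^sup>2 - \<epsilon> * Re ((D k)\<^sup>2 * root_exp n (2 * R * k)))))"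
  proof (rule sum.cong[OF refl])
    fix k
    have "D k * cnj (E k) - E k * cnj (D k) = D k * cnj (E k) - cnj (D k * cnj (E k))" by simp
    then have "(cmod (D k * cnj (E k) - E k * cnj (D k)))\<^sup>2
      = 2 * (cmod (D k * cnj (E k)))\<^sup>2 - 2 * Re ((D k * cnj (E k))\<^sup>2)"
      by (simp only: norm_diff_cnj_square)
    also have "(cmod (D k * cnj (E k)))\<^sup>2 = real n * (chi k)\<^sup>2 * (cmod (D k))\<^sup>2"
      by (simp add: norm_mult power_mult_distrib norm_E_square)
    also have "(D k * cnj (E k))\<^sup>2
        = of_real (\<epsilon> * real n * (chi k)\<^sup>2) * ((D k)\<^sup>2 * root_exp n (2 * R * k))"
      by (simp only: power_mult_distrib cnj_E_square mult_ac)
    also have "Re \<dots> = \<epsilon> * real n * (chi k)\<^sup>2 * Re ((D k)\<^sup>2 * root_exp n (2 * R * k))"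
      by (simp only: times_complex.sel Re_complex_of_real Im_complex_of_real mult_zero_left diff_zero)
    finally show "(cmod (D k * cnj (E k) - E k * cnj (D k)))\<^sup>2
      = 2 * real n * ((chi k)\<^sup>2 * ((cmod (D k))\<^sup>2 - \<epsilon> * Re ((D k)\<^sup>2 * root_exp n (2 * R * k))))"
      by (simp add: algebra_simps)
  qed
  finally show ?thesis by (simp only: sum_distrib_left)
qed

text \<open>Writing \<open>chi (j + R) * G\<close> as a sum over \<open>l\<close> expresses
  \<open>G * D k\<close> through linearly weighted exponential sums at the frequencies
  \<open>l + k\<close>. Only frequency zero lacks cancellation, and it occurs at
  \<open>l = -k\<close>, where \<open>chi l\<close> vanishes with \<open>chi k\<close>. The rest is
  at most \<open>n^2 * ln n\<close>; dividing its square by \<open>n\<close>, the squared modulus of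
  \<open>G\<close>, gives the bound.\<close>

lemma norm_D_square_le:
  assumes "chi k = 0"
  shows "(cmod (D k))\<^sup>2 \<le> real n ^ 3 * (ln (real n))\<^sup>2"
proof -
  \<comment> \<open>The default 0 at multiples of \<open>n\<close> drops the frequency killed by
    \<open>chi l = 0\<close> and keeps \<open>h\<close> periodic, so that the shift by
    \<open>k\<close> can be removed.\<close>
  define h where "h m = (if int n dvd m then 0 else cmod (\<Sum>j\<in>I. of_int j * root_exp n (m * j)))" for m
  have h_nonneg: "h m \<ge> 0" for m by (simp add: h_def)
  have h_mod: "h (m mod int n) = h m" for m
  proof -
    have "root_exp n (m mod int n * j) = root_exp n (m * j)" for j
      using n_pos by (intro root_exp_cong) (auto simp: cong_def mod_mult_left_eq)
    then show ?thesis by (simp add: h_def dvd_mod_iff)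
  qed
  have "G * D k = (\<Sum>j\<in>I. of_int j * root_exp n (j * k) * (of_real (chi (j + R)) * G))"
    unfolding D_def sum_distrib_left by (intro sum.cong refl) (simp add: a_def)
  also have "\<dots> = (\<Sum>j\<in>I. \<Sum>l\<in>I. of_real (chi l) * root_exp n (l * R) * (of_int j * root_exp n ((l + k) * j)))"
    unfolding gauss_sum[symmetric] sum_distrib_left
    by (intro sum.cong refl) (simp add: root_exp_add algebra_simps)
  also have "\<dots> = (\<Sum>l\<in>I. of_real (chi l) * root_exp n (l * R) * (\<Sum>j\<in>I. of_int j * root_exp n ((l + k) * j)))"
    by (subst sum.swap) (simp add: sum_distrib_left)
  finally have "cmod (G * D k) \<le> (\<Sum>l\<in>I. cmod (of_real (chi l) * root_exp n (l * R) * (\<Sum>j\<in>I. of_int j * root_exp n ((l + k) * j))))"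
    by (simp only: norm_sum)
  also have "\<dots> \<le> (\<Sum>l\<in>I. h (l + k))"
  proof (rule sum_mono)
    fix l
    show "cmod (of_real (chi l) * root_exp n (l * R) * (\<Sum>j\<in>I. of_int j * root_exp n ((l + k) * j))) \<le> h (l + k)"
    proof (cases "int n dvd l + k")
      case True
      then have "[l = - k] (mod int n)" by (simp add: cong_iff_dvd_diff)
      then have "chi l = 0" using chi_cong chi_minus assms by simp
      then show ?thesis using h_nonneg by simp
    next
      case False
      have "\<bar>chi l\<bar> \<le> 1" using chi_values[of l] by auto
      then show ?thesis using False by (simp add: h_def norm_mult mult_left_le_one_le)
    qed
  qed
  also have "\<dots> = (\<Sum>l\<in>I. h l)"
    by (rule sum_mod_shift) (use n_pos h_mod in auto)
  also have "\<dots> = (\<Sum>l\<in>{0<..<int n}. h l)"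
    by (rule sum.mono_neutral_right) (auto simp: h_def)
  also have "\<dots> = (\<Sum>s\<in>{0<..<int n}. cmod (\<Sum>j\<in>I. of_int j * root_exp n (s * j)))"
    by (intro sum.cong refl) (auto simp: h_def dest: zdvd_imp_le)
  also have "\<dots> \<le> (real n)\<^sup>2 * ln (real n)"
    by (rule sum_norm_sum_linear_root_exp_le[OF n_ge_3])
  finally have "(cmod (G * D k))\<^sup>2 \<le> ((real n)\<^sup>2 * ln (real n))\<^sup>2"
    by (intro power_mono) auto
  then have "real n * (cmod (D k))\<^sup>2 \<le> real n * (real n ^ 3 * (ln (real n))\<^sup>2)"
    unfolding norm_mult power_mult_distrib norm_gauss_sum by (simp add: eval_nat_numeral mult_ac)
  then show ?thesis using n_pos by simp
qed

text \<open>Two replacements cause the error: putting 1 for the square of \<open>chi k\<close> among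
  the frequencies, which costs the term with the logarithm by \<open>norm_D_square_le\<close>, and
  putting 1 for the square of \<open>a j\<close> in the resulting sum, which costs the term
  2.\<close>

lemma sum_L_square_estimate:
  "\<bar>(\<Sum>u\<in>I. (L u)\<^sup>2) - 2 * real n * (\<Sum>j\<in>I. of_int (j * (j - reflect j)))\<bar>
    \<le> real (card zeros) * real n ^ 3 * (4 * (ln (real n))\<^sup>2 + 2)"
proof -
  define t where "t k = (cmod (D k))\<^sup>2 - \<epsilon> * Re ((D k)\<^sup>2 * root_exp n (2 * R * k))" for k
  have abs_eps: "\<bar>\<epsilon>\<bar> = 1" using eps_square by (simp add: power2_eq_1_iff) linarith
  \<comment> \<open>Over all residues both moments of \<open>D\<close> are known exactly, and the
    two factors \<open>\<epsilon>\<close> cancel.\<close>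
  have sum_t: "(\<Sum>k\<in>I. t k) = real n * (\<Sum>j\<in>I. (a j)\<^sup>2 * of_int (j * (j - reflect j)))"
  proof -
    have "(\<Sum>k\<in>I. t k) = (\<Sum>k\<in>I. (cmod (D k))\<^sup>2) - \<epsilon> * Re (\<Sum>k\<in>I. (D k)\<^sup>2 * root_exp n (2 * R * k))"
      by (simp only: t_def sum_subtractf sum_distrib_left Re_sum)
    also have "\<dots> = real n * (\<Sum>j\<in>I. (a j)\<^sup>2 * of_int (j * j))
        - \<epsilon>\<^sup>2 * real n * (\<Sum>j\<in>I. (a j)\<^sup>2 * of_int (j * reflect j))"
      unfolding sum_norm_D_square sum_D_square_root_exp by (simp add: power2_eq_square)
    finally show ?thesis
      by (simp add: eps_square sum_subtractf algebra_simps)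
  qed
  have abs_t: "\<bar>t k\<bar> \<le> 2 * (real n ^ 3 * (ln (real n))\<^sup>2)" if "chi k = 0" for k
  proof -
    have "\<bar>Re ((D k)\<^sup>2 * root_exp n (2 * R * k))\<bar> \<le> cmod ((D k)\<^sup>2 * root_exp n (2 * R * k))"
      by (rule abs_Re_le_cmod)
    then have "\<bar>\<epsilon> * Re ((D k)\<^sup>2 * root_exp n (2 * R * k))\<bar> \<le> (cmod (D k))\<^sup>2"
      by (simp add: abs_mult abs_eps norm_mult norm_power)
    moreover have "\<bar>(cmod (D k))\<^sup>2\<bar> = (cmod (D k))\<^sup>2" by simp
    ultimately have "\<bar>t k\<bar> \<le> 2 * (cmod (D k))\<^sup>2" unfolding t_def by linarith
    with norm_D_square_le[OF that] show ?thesis by linarith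
  qed
  have "(\<Sum>k\<in>I. t k) - (\<Sum>k\<in>I. (chi k)\<^sup>2 * t k) = (\<Sum>k\<in>zeros. t k)"
  proof -
    have "(\<Sum>k\<in>I. t k) - (\<Sum>k\<in>I. (chi k)\<^sup>2 * t k) = (\<Sum>k\<in>I. if chi k = 0 then t k else 0)"
      unfolding sum_subtractf[symmetric] by (intro sum.cong refl) (auto simp: chi_square)
    then show ?thesis by (simp add: zeros_def sum.If_cases Int_def)
  qed
  moreover have "\<bar>\<Sum>k\<in>zeros. t k\<bar> \<le> real (card zeros) * (2 * (real n ^ 3 * (ln (real n))\<^sup>2))"
    by (intro order_trans[OF sum_abs] sum_bounded_above abs_t) (auto simp: zeros_def)
  ultimately have 1: "\<bar>(\<Sum>k\<in>I. (chi k)\<^sup>2 * t k) - (\<Sum>k\<in>I. t k)\<bar>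
      \<le> real (card zeros) * (2 * (real n ^ 3 * (ln (real n))\<^sup>2))" by linarith
  have "real n * (\<Sum>u\<in>I. (L u)\<^sup>2) = real n * (2 * (\<Sum>k\<in>I. (chi k)\<^sup>2 * t k))"
    unfolding n_sum_L_square t_def by simp
  then have L: "(\<Sum>u\<in>I. (L u)\<^sup>2) = 2 * (\<Sum>k\<in>I. (chi k)\<^sup>2 * t k)"
    using n_pos by simp
  have "\<bar>(\<Sum>j\<in>I. of_int (j * (j - reflect j))) - (\<Sum>j\<in>I. (a j)\<^sup>2 * of_int (j * (j - reflect j)))\<bar>
      = \<bar>\<Sum>j\<in>I. (1 - (a j)\<^sup>2) * of_int (j * (j - reflect j))\<bar>"
    by (simp add: sum_subtractf[symmetric] algebra_simps)
  also have "\<dots> \<le> (\<Sum>j\<in>I. (1 - (a j)\<^sup>2) * (real n)\<^sup>2)"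
  proof (intro order_trans[OF sum_abs] sum_mono)
    fix j assume j: "j \<in> I"
    have "1 - (a j)\<^sup>2 \<ge> 0" using abs_a_le[of j] by (simp add: abs_square_le_1)
    moreover have "\<bar>real_of_int (j * (j - reflect j))\<bar> \<le> (real n)\<^sup>2"
    proof -
      have "\<bar>real_of_int j\<bar> \<le> real n" "\<bar>real_of_int (j - reflect j)\<bar> \<le> real n"
        using j reflect_mem[of j] by auto
      then show ?thesis
        by (simp only: of_int_mult abs_mult power2_eq_square) (intro mult_mono, auto)
    qed
    ultimately show "\<bar>(1 - (a j)\<^sup>2) * of_int (j * (j - reflect j))\<bar> \<le> (1 - (a j)\<^sup>2) * (real n)\<^sup>2"
      by (simp only: abs_mult) (intro mult_mono, auto)
  qed
  also have "\<dots> = real (card zeros) * (real n)\<^sup>2"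
    by (simp add: sum_distrib_right[symmetric] sum_one_minus_a_square)
  finally have 2: "\<bar>(\<Sum>j\<in>I. of_int (j * (j - reflect j))) - (\<Sum>j\<in>I. (a j)\<^sup>2 * of_int (j * (j - reflect j)))\<bar>
      \<le> real (card zeros) * (real n)\<^sup>2" .
  have 3: "\<bar>real n * (\<Sum>j\<in>I. of_int (j * (j - reflect j))) - (\<Sum>k\<in>I. t k)\<bar> \<le> real n * (real (card zeros) * (real n)\<^sup>2)"
    unfolding sum_t right_diff_distrib[symmetric] abs_mult using mult_left_mono[OF 2, of "real n"] by simp
  have "\<bar>(\<Sum>u\<in>I. (L u)\<^sup>2) - 2 * real n * (\<Sum>j\<in>I. of_int (j * (j - reflect j)))\<bar>
      \<le> 2 * (real (card zeros) * (2 * (real n ^ 3 * (ln (real n))\<^sup>2))) + 2 * (real n * (real (card zeros) * (real n)\<^sup>2))"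
    unfolding L using 1 3 by linarith
  also have "\<dots> = real (card zeros) * real n ^ 3 * (4 * (ln (real n))\<^sup>2 + 2)"
    by (simp add: algebra_simps eval_nat_numeral)
  finally show ?thesis .
qed

section \<open>Comparison of the aperiodic correlations with \<open>L\<close>\<close>

lemma L_0: "L 0 = 0"
  unfolding L_def
proof (intro sum.neutral ballI)
  fix j l assume "j \<in> I" "l \<in> I"
  then have "j = l" if "(j - l) mod int n = 0"
    using that by (auto simp flip: cong_iff_dvd_diff simp: mod_eq_0_iff_dvd cong_def)
  then show "(if (j - l) mod int n = 0 then of_int (j - l) * (a j * a l) else 0) = 0" by auto
qed

text \<open>Dividing \<open>n_times_C\<close> by n^2 splits the normalised \<open>C\<close> into
  \<open>x + y\<close>, with \<open>y\<close> coming from \<open>P\<close>. The triangle inequality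
  in both directions compares the Euclidean norms without any estimate of cross terms, and
  \<open>sum_P_square\<close> bounds the norm of \<open>y\<close>.\<close>

lemma sqrt_sum_C_square_estimate:
  "\<bar>sqrt (\<Sum>u\<in>{0<..<int n}. (C u)\<^sup>2) / real n - sqrt (\<Sum>u\<in>I. (L u)\<^sup>2) / (real n)\<^sup>2\<bar>
    \<le> sqrt (real (card zeros) / real n)"
proof -
  let ?U = "{0<..<int n}"
  define c where "c u = C u / real n" for u
  define x where "x u = L u / (real n)\<^sup>2" for u
  define y where "y u = (1 - of_int u / real n) * (P u / real n)" for u
  have n: "real n > 0" using n_pos by simp
  have c_eq: "c u = x u + y u" if "u \<in> ?U" for u
  proof -
    have "real n * C u = L u + (real n - of_int u) * P u" using that by (intro n_times_C) auto
    then have "real n * C u / (real n)\<^sup>2 = (L u + (real n - of_int u) * P u) / (real n)\<^sup>2" by simp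
    then show ?thesis using n by (simp add: c_def x_def y_def field_simps power2_eq_square)
  qed
  have "L2_set c ?U = L2_set (\<lambda>u. x u + y u) ?U"
    by (intro L2_set_cong refl c_eq)
  also have "\<dots> \<le> L2_set x ?U + L2_set y ?U" by (rule L2_set_triangle_ineq)
  finally have 1: "L2_set c ?U \<le> L2_set x ?U + L2_set y ?U" .
  have "L2_set x ?U = L2_set (\<lambda>u. c u + - y u) ?U"
    by (intro L2_set_cong refl) (use c_eq in force)
  also have "\<dots> \<le> L2_set c ?U + L2_set (\<lambda>u. - y u) ?U" by (rule L2_set_triangle_ineq)
  also have "L2_set (\<lambda>u. - y u) ?U = L2_set y ?U" by (simp add: L2_set_def)
  finally have 2: "L2_set x ?U \<le> L2_set c ?U + L2_set y ?U" .
  have "(\<Sum>u\<in>?U. (y u)\<^sup>2) \<le> (\<Sum>u\<in>?U. (P u / real n)\<^sup>2)"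
  proof (rule sum_mono)
    fix u assume u: "u \<in> ?U"
    have "0 \<le> of_int u / real n" "of_int u / real n \<le> 1" using u n by auto
    then have "(1 - of_int u / real n)\<^sup>2 \<le> 1" by (simp add: abs_square_le_1)
    then show "(y u)\<^sup>2 \<le> (P u / real n)\<^sup>2"
      unfolding y_def power_mult_distrib by (intro mult_left_le_one_le) auto
  qed
  also have "\<dots> = real (card zeros) * (real n - real (card zeros)) / (real n)\<^sup>2"
    by (simp add: power_divide sum_divide_distrib[symmetric] sum_P_square)
  also have "\<dots> \<le> real (card zeros) * real n / (real n)\<^sup>2"
    by (intro divide_right_mono mult_left_mono) auto
  also have "\<dots> = real (card zeros) / real n"
    using n by (simp add: power2_eq_square)
  finally have y: "L2_set y ?U \<le> sqrt (real (card zeros) / real n)"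
    unfolding L2_set_def by (rule real_sqrt_le_mono)
  have c: "L2_set c ?U = sqrt (\<Sum>u\<in>?U. (C u)\<^sup>2) / real n"
    using n by (simp add: L2_set_def c_def power_divide sum_divide_distrib[symmetric] real_sqrt_divide)
  have "I = insert 0 ?U" using n_pos by auto
  then have "(\<Sum>u\<in>I. (L u)\<^sup>2) = (\<Sum>u\<in>?U. (L u)\<^sup>2)" by (simp add: L_0)
  moreover have "sqrt (real n ^ 4) = (real n)\<^sup>2"
    using real_sqrt_abs[of "(real n)\<^sup>2"] by (simp flip: power_mult)
  ultimately have x: "L2_set x ?U = sqrt (\<Sum>u\<in>I. (L u)\<^sup>2) / (real n)\<^sup>2"
    using n by (simp add: L2_set_def x_def power_divide sum_divide_distrib[symmetric] real_sqrt_divide)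
  show ?thesis using 1 2 y unfolding c x by linarith
qed

section \<open>Evaluation of the elementary sum over residues\<close>

lemma sum_linear_quadratic:
  "6 * (\<Sum>j\<in>{0..<int m}. j * (2 * j - c)) = 2 * int m * (int m - 1) * (2 * int m - 1) - 3 * c * int m * (int m - 1)"
proof (induction m)
  case (Suc m)
  have "{0..<int (Suc m)} = insert (int m) {0..<int m}" by auto
  then have "6 * (\<Sum>j\<in>{0..<int (Suc m)}. j * (2 * j - c))
      = 6 * (int m * (2 * int m - c)) + 6 * (\<Sum>j\<in>{0..<int m}. j * (2 * j - c))" by simp
  also have "\<dots> = 2 * int (Suc m) * (int (Suc m) - 1) * (2 * int (Suc m) - 1)
      - 3 * c * int (Suc m) * (int (Suc m) - 1)"
    unfolding Suc.IH by (simp add: algebra_simps)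
  finally show ?case .
qed simp

text \<open>Since \<open>reflect j\<close> is \<open>T - j\<close> for \<open>j \<le> T\<close> and
  \<open>T + n - j\<close> beyond, \<open>j - reflect j\<close> is the linear form
  \<open>2 * j - (T + n)\<close> plus a correction \<open>n\<close> for \<open>j \<le> T\<close>.
  The factor 6 keeps the identity in the integers.\<close>

lemma sum_reflect:
  fixes T :: int
  defines "T \<equiv> (- 2 * R) mod int n"
  shows "6 * (\<Sum>j\<in>I. j * (j - reflect j))
    = 2 * int n * (int n - 1) * (2 * int n - 1) - 3 * (T + int n) * int n * (int n - 1) + 3 * int n * T * (T + 1)"
proof -
  have T: "0 \<le> T" "T < int n" using n_pos by (auto simp: T_def)
  have refl: "reflect j = (if j \<le> T then T - j else T + int n - j)" if "j \<in> I" for j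
  proof -
    have "reflect j = (T - j) mod int n" by (simp add: reflect_def T_def mod_diff_left_eq)
    also have "\<dots> = (if j \<le> T then T - j else T + int n - j)"
    proof (cases "j \<le> T")
      case True
      then show ?thesis using that T by simp
    next
      case False
      have "(T - j) mod int n = (T - j + int n) mod int n" by simp
      also have "\<dots> = T - j + int n" using that T False by (intro mod_pos_pos_trivial) auto
      finally show ?thesis using False by simp
    qed
    finally show ?thesis .
  qed
  have "(\<Sum>j\<in>I. j * (j - reflect j)) = (\<Sum>j\<in>I. j * (2 * j - (T + int n)) + (if j \<le> T then int n * j else 0))"
    by (intro sum.cong refl) (auto simp: refl algebra_simps)
  also have "\<dots> = (\<Sum>j\<in>I. j * (2 * j - (T + int n))) + (\<Sum>j\<in>I. if j \<le> T then int n * j else 0)"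
    by (rule sum.distrib)
  also have "(\<Sum>j\<in>I. if j \<le> T then int n * j else 0) = (\<Sum>j\<in>{0..<T + 1}. int n * j)"
    using T by (intro sum.mono_neutral_cong_right) auto
  finally have S: "(\<Sum>j\<in>I. j * (j - reflect j)) = (\<Sum>j\<in>I. j * (2 * j - (T + int n))) + int n * (\<Sum>j\<in>{0..<T + 1}. j)"
    by (simp only: sum_distrib_left)
  \<comment> \<open>The sum of \<open>j\<close> is obtained as the difference of the instances
    \<open>c = 0\<close> and \<open>c = 1\<close> of \<open>sum_linear_quadratic\<close>.\<close>
  have "(\<Sum>j\<in>{0..<T + 1}. j * (2 * j - 0)) - (\<Sum>j\<in>{0..<T + 1}. j * (2 * j - 1)) = (\<Sum>j\<in>{0..<T + 1}. j)"
    by (simp add: sum_subtractf[symmetric] algebra_simps)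
  moreover have "6 * (\<Sum>j\<in>{0..<T + 1}. j * (2 * j - c)) = 2 * (T + 1) * T * (2 * T + 1) - 3 * c * (T + 1) * T" for c
    using sum_linear_quadratic[where m = "nat (T + 1)" and c = c] T by simp
  from this[of 0] this[of 1] have "6 * (\<Sum>j\<in>{0..<T + 1}. j * (2 * j - 0))
      - 6 * (\<Sum>j\<in>{0..<T + 1}. j * (2 * j - 1)) = 3 * T * (T + 1)"
    by (simp only:) (simp add: algebra_simps)
  ultimately have "6 * (\<Sum>j\<in>{0..<T + 1}. j) = 3 * T * (T + 1)"
    by linarith
  then have "6 * (int n * (\<Sum>j\<in>{0..<T + 1}. j)) = int n * (3 * T * (T + 1))"
    by simp
  then show ?thesis
    unfolding S distrib_left sum_linear_quadratic by (simp add: algebra_simps)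
qed

lemma sum_reflect_estimate:
  fixes t :: real
  defines "t \<equiv> of_int ((- 2 * R) mod int n) / real n"
  shows "\<bar>(\<Sum>j\<in>I. of_int (j * (j - reflect j))) / real n ^ 3 - (1 / 6 - t * (1 - t) / 2)\<bar> \<le> 1 / real n"
proof -
  define N where "N = real n"
  have N: "N \<ge> 3" using n_ge_3 by (simp add: N_def)
  define T where "T = (- 2 * R) mod int n"
  have T: "0 \<le> T" "T < int n" using n_pos by (auto simp: T_def)
  have TN: "of_int T = t * N" using N by (simp add: t_def T_def N_def)
  have "t = of_int T / N" by (simp add: t_def T_def N_def)
  then have t: "0 \<le> t" "t \<le> 1" using T N by (auto simp: N_def)
  have "6 * (\<Sum>j\<in>I. of_int (j * (j - reflect j)) :: real) = of_int (6 * (\<Sum>j\<in>I. j * (j - reflect j)))"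
    by simp
  also have "\<dots> = 2 * N * (N - 1) * (2 * N - 1) - 3 * (t * N + N) * N * (N - 1) + 3 * N * (t * N) * (t * N + 1)"
    unfolding sum_reflect T_def[symmetric] by (simp add: TN[unfolded N_def] N_def)
  finally have S: "(\<Sum>j\<in>I. of_int (j * (j - reflect j)) :: real)
      = (2 * N * (N - 1) * (2 * N - 1) - 3 * (t * N + N) * N * (N - 1) + 3 * N * (t * N) * (t * N + 1)) / 6"
    by (metis nonzero_mult_div_cancel_left zero_neq_numeral)
  \<comment> \<open>With \<open>T = t * N\<close> the cubic terms give the main term; the right side
    collects exactly the terms of lower order.\<close>
  have "(\<Sum>j\<in>I. of_int (j * (j - reflect j))) / N ^ 3 - (1 / 6 - t * (1 - t) / 2)
      = (t - 1 / 2 + 1 / (3 * N)) / N"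
    unfolding S using N by (simp add: field_simps eval_nat_numeral)
  moreover have "\<bar>(t - 1 / 2 + 1 / (3 * N)) / N\<bar> \<le> 1 / N"
  proof -
    have "0 \<le> 1 / (3 * N)" "1 / (3 * N) \<le> 1 / 2" using N by (auto simp: field_simps)
    then have "\<bar>t - 1 / 2 + 1 / (3 * N)\<bar> \<le> 1" using t by linarith
    then show ?thesis using N by (simp add: divide_right_mono)
  qed
  ultimately show ?thesis by (simp add: N_def)
qed

section \<open>The merit factor in terms of correlations\<close>

lemma norm_square_trig_sum:
  "complex_of_real ((cmod (\<Sum>j\<in>I. of_real (a j) * cis (of_int j * \<theta>)))\<^sup>2)
    = (\<Sum>v\<in>{- int n<..<int n}. of_real (C v) * cis (of_int v * \<theta>))"
proof -
  let ?V = "{- int n<..<int n}"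
  let ?w = "\<lambda>j l. complex_of_real (a j * a l) * cis (of_int (j - l) * \<theta>)"
  have "complex_of_real ((cmod (\<Sum>j\<in>I. of_real (a j) * cis (of_int j * \<theta>)))\<^sup>2) = (\<Sum>j\<in>I. \<Sum>l\<in>I. ?w j l)"
    unfolding complex_norm_square cnj_sum sum_product
    by (intro sum.cong refl) (simp add: cis_cnj cis_mult algebra_simps)
  also have "\<dots> = (\<Sum>j\<in>I. \<Sum>l\<in>I. \<Sum>v\<in>?V. if j - l = v then ?w j l else 0)"
    by (intro sum.cong refl) auto
  also have "\<dots> = (\<Sum>j\<in>I. \<Sum>v\<in>?V. \<Sum>l\<in>I. if j - l = v then ?w j l else 0)"
    by (intro sum.cong refl sum.swap)
  also have "\<dots> = (\<Sum>v\<in>?V. \<Sum>j\<in>I. \<Sum>l\<in>I. if j - l = v then ?w j l else 0)"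
    by (rule sum.swap)
  also have "\<dots> = (\<Sum>v\<in>?V. of_real (C v) * cis (of_int v * \<theta>))"
    unfolding C_def of_real_sum sum_distrib_right by (intro sum.cong refl) auto
  finally show ?thesis .
qed

lemma sum_C_square:
  "(\<Sum>v\<in>{- int n<..<int n}. (C v)\<^sup>2) = (C 0)\<^sup>2 + 2 * (\<Sum>u\<in>{0<..<int n}. (C u)\<^sup>2)"
proof -
  have "{- int n<..<int n} = insert 0 ({- int n<..<0} \<union> {0<..<int n})" using n_pos by auto
  then have "(\<Sum>v\<in>{- int n<..<int n}. (C v)\<^sup>2)
      = (C 0)\<^sup>2 + ((\<Sum>v\<in>{- int n<..<0}. (C v)\<^sup>2) + (\<Sum>u\<in>{0<..<int n}. (C u)\<^sup>2))"
    by (simp add: sum.union_disjoint)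
  also have "(\<Sum>v\<in>{- int n<..<0}. (C v)\<^sup>2) = (\<Sum>u\<in>{0<..<int n}. (C u)\<^sup>2)"
    by (rule sum.reindex_bij_witness[of _ uminus uminus]) (auto simp: C_minus)
  finally show ?thesis by simp
qed

lemma merit_factor_eq:
  assumes "\<And>\<theta>. poly A (cis \<theta>) = (\<Sum>j\<in>I. of_real (a j) * cis (of_int j * \<theta>))"
  shows "merit_factor A = (C 0)\<^sup>2 / (2 * (\<Sum>u\<in>{0<..<int n}. (C u)\<^sup>2))"
proof -
  have C0: "C 0 \<ge> 0"
    unfolding C_0 sum_a_square[symmetric] by (intro sum_nonneg) auto
  have "(1 / (2 * pi)) * integral {0..2*pi} (\<lambda>\<theta>. cmod (poly A (cis \<theta>)) powr 2)
      = (\<Sum>j\<in>I. (cmod (of_real (a j)))\<^sup>2)"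
    unfolding assms using integral_norm_trig_sum_square[of I "\<lambda>j. of_real (a j)"] by simp
  also have "\<dots> = C 0" by (simp add: C_0 sum_a_square)
  finally have 2: "lnorm 2 A ^ 4 = (C 0)\<^sup>2"
    unfolding lnorm_def using C0 by (simp add: powr_half_sqrt power4_eq_xxxx power2_eq_square)
  have "(1 / (2 * pi)) * integral {0..2*pi} (\<lambda>\<theta>. cmod (poly A (cis \<theta>)) powr 4)
      = (1 / (2 * pi)) * integral {0..2*pi} (\<lambda>\<theta>. (cmod (of_real ((cmod (poly A (cis \<theta>)))\<^sup>2)))\<^sup>2)"
    by (simp add: norm_power flip: power_mult)
  also have "\<dots> = (\<Sum>v\<in>{- int n<..<int n}. (cmod (of_real (C v)))\<^sup>2)"
    unfolding assms norm_square_trig_sum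
    using integral_norm_trig_sum_square[of "{- int n<..<int n}" "\<lambda>v. of_real (C v)"] by simp
  finally have 4: "(1 / (2 * pi)) * integral {0..2*pi} (\<lambda>\<theta>. cmod (poly A (cis \<theta>)) powr 4)
      = (\<Sum>v\<in>{- int n<..<int n}. (C v)\<^sup>2)" by simp
  have "(x powr (1 / 4)) ^ 4 = x" if "x \<ge> 0" for x :: real
    using that by (cases "x = 0") (auto simp: powr_power)
  then have "lnorm 4 A ^ 4 = (\<Sum>v\<in>{- int n<..<int n}. (C v)\<^sup>2)"
    unfolding lnorm_def 4 by (simp add: sum_nonneg)
  with 2 show ?thesis unfolding merit_factor_def sum_C_square by simp
qed

text \<open>Here \<open>q\<close> is the Euclidean norm of \<open>C\<close> on positive shifts
  divided by \<open>n\<close>, and \<open>x\<close> is the sum of squares of \<open>L\<close>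
  divided by n^4. Hiding both behind quantifiers leaves only real inequalities for the passage to
  the limit.\<close>

lemma merit_factor_estimates:
  fixes t :: real
  assumes "\<And>\<theta>. poly A (cis \<theta>) = (\<Sum>j\<in>I. of_real (a j) * cis (of_int j * \<theta>))"
  defines "t \<equiv> of_int ((- 2 * R) mod int n) / real n"
  defines "\<delta> \<equiv> real (card zeros) / real n"
  shows "\<exists>q x. merit_factor A = (1 - \<delta>)\<^sup>2 / (2 * q\<^sup>2) \<and> \<bar>q - sqrt x\<bar> \<le> sqrt \<delta>
    \<and> \<bar>x - (1 / 3 - t * (1 - t))\<bar> \<le> \<delta> * (4 * (ln (real n))\<^sup>2 + 2) + 2 / real n"
proof (intro exI conjI)
  let ?Q = "\<Sum>u\<in>{0<..<int n}. (C u)\<^sup>2"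
  let ?L = "\<Sum>u\<in>I. (L u)\<^sup>2"
  let ?S = "\<Sum>j\<in>I. of_int (j * (j - reflect j)) :: real"
  define N where "N = real n"
  have N: "N > 0" using n_pos by (simp add: N_def)
  have "(1 - \<delta>)\<^sup>2 = (C 0 / N)\<^sup>2" using N by (simp add: \<delta>_def C_0 N_def field_simps)
  moreover have "(sqrt ?Q / N)\<^sup>2 = ?Q / N\<^sup>2" by (simp add: power_divide sum_nonneg)
  ultimately show "merit_factor A = (1 - \<delta>)\<^sup>2 / (2 * (sqrt ?Q / N)\<^sup>2)"
    unfolding merit_factor_eq[OF assms(1)] using N by (simp add: power_divide)
  have "sqrt (N ^ 4) = N\<^sup>2"
    using real_sqrt_abs[of "N\<^sup>2"] by (simp flip: power_mult)
  then have "sqrt (?L / N ^ 4) = sqrt ?L / N\<^sup>2" by (simp add: real_sqrt_divide)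
  then show "\<bar>sqrt ?Q / N - sqrt (?L / N ^ 4)\<bar> \<le> sqrt \<delta>"
    using sqrt_sum_C_square_estimate by (simp add: N_def \<delta>_def)
  have "\<bar>?L / N ^ 4 - 2 * ?S / N ^ 3\<bar> = \<bar>?L - 2 * N * ?S\<bar> / N ^ 4"
  proof -
    have "?L / N ^ 4 - 2 * ?S / N ^ 3 = (?L - 2 * N * ?S) / N ^ 4"
      using N by (simp add: diff_divide_distrib eval_nat_numeral)
    then show ?thesis using N by simp
  qed
  also have "\<dots> \<le> real (card zeros) * N ^ 3 * (4 * (ln N)\<^sup>2 + 2) / N ^ 4"
    using sum_L_square_estimate N by (intro divide_right_mono) (auto simp: N_def)
  also have "\<dots> = \<delta> * (4 * (ln N)\<^sup>2 + 2)"
    using N by (simp add: \<delta>_def N_def eval_nat_numeral)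
  finally have "\<bar>?L / N ^ 4 - 2 * ?S / N ^ 3\<bar> \<le> \<delta> * (4 * (ln N)\<^sup>2 + 2)" .
  moreover have "\<bar>2 * ?S / N ^ 3 - (1 / 3 - t * (1 - t))\<bar> \<le> 2 / N"
  proof -
    have "2 * ?S / N ^ 3 - (1 / 3 - t * (1 - t)) = 2 * (?S / N ^ 3 - (1 / 6 - t * (1 - t) / 2))"
      by (simp add: field_simps)
    moreover have "\<bar>?S / N ^ 3 - (1 / 6 - t * (1 - t) / 2)\<bar> \<le> 1 / N"
      using sum_reflect_estimate by (simp add: t_def N_def)
    ultimately show ?thesis by (simp only: abs_mult)
  qed
  ultimately show "\<bar>?L / N ^ 4 - (1 / 3 - t * (1 - t))\<bar> \<le> \<delta> * (4 * (ln (real n))\<^sup>2 + 2) + 2 / real n"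
    unfolding N_def by linarith
qed

end

end

subsection \<open>Rotated character polynomials\<close>

lemma card_multiples_le:
  assumes "p > 0" "p dvd n"
  shows "card {k \<in> {0..<int n}. int p dvd k} \<le> n div p"
proof -
  have "{k \<in> {0..<int n}. int p dvd k} \<subseteq> (\<lambda>i. int p * int i) ` {..<n div p}"
  proof
    fix k assume "k \<in> {k \<in> {0..<int n}. int p dvd k}"
    then obtain i where i: "k = int p * i" "0 \<le> k" "k < int n" by (auto elim: dvdE)
    then have "i \<ge> 0" using assms by (simp add: zero_le_mult_iff)
    then obtain m where m: "i = int m" by (metis nonneg_int_cases)
    have "int n = int p * int (n div p)" using assms by (metis dvd_mult_div_cancel of_nat_mult)
    then have "int p * int m < int p * int (n div p)" using i m by simp
    then have "m < n div p" using assms by simp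
    then show "k \<in> (\<lambda>i. int p * int i) ` {..<n div p}" using i m by auto
  qed
  then have "card {k \<in> {0..<int n}. int p dvd k} \<le> card ((\<lambda>i. int p * int i) ` {..<n div p})"
    by (intro card_mono) auto
  also have "\<dots> \<le> card {..<n div p}" by (rule card_image_le) simp
  finally show ?thesis by simp
qed

text \<open>As \<open>n\<close> is odd, each of its prime factors is at least 3, so 3 to their
  number is at most \<open>n\<close>; and \<open>ln 3 \<ge> 1\<close>.\<close>

lemma card_prime_factors_le_ln:
  assumes "odd n"
  shows "real (card (prime_factors n)) \<le> ln (real n)"
proof -
  have n: "n > 0" using assms by (auto intro: Nat.gr0I)
  have "(3::nat) ^ card (prime_factors n) = (\<Prod>p\<in>prime_factors n. 3)" by simp
  also have "\<dots> \<le> (\<Prod>p\<in>prime_factors n. p ^ multiplicity p n)"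
  proof (rule prod_mono, safe)
    fix p assume p: "p \<in> prime_factors n"
    then have "prime p" "p dvd n" by auto
    moreover have "p \<noteq> 2" using \<open>p dvd n\<close> assms by auto
    ultimately have "3 \<le> p" using prime_ge_2_nat[of p] by linarith
    also have "p \<le> p ^ multiplicity p n"
      using p \<open>3 \<le> p\<close> prime_factors_multiplicity[of n] by (intro self_le_power) auto
    finally show "3 \<le> p ^ multiplicity p n" .
  qed
  also have "\<dots> = n" using n by (simp add: prime_factorization_nat[symmetric])
  finally have "real (3 ^ card (prime_factors n)) \<le> real n" by (rule of_nat_mono)
  then have "ln (3 ^ card (prime_factors n)) \<le> ln (real n)" using n by (subst ln_le_cancel_iff) auto
  then have "real (card (prime_factors n)) * ln 3 \<le> ln (real n)" by (simp add: ln_realpow)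
  moreover have "real (card (prime_factors n)) * 1 \<le> real (card (prime_factors n)) * ln 3"
    by (intro mult_left_mono ln_ge_1) auto
  ultimately show ?thesis by simp
qed

context
  fixes n :: nat
  assumes odd_n: "odd n" and squarefree_n: "squarefree n" and n_gt_1: "n > 1"
begin

lemma odd_gt_1_imp_ge_3: "n \<ge> 3"
  using odd_n n_gt_1 by (cases "n = 2") auto

lemma smallest_prime_factor_in: "smallest_prime_factor n \<in> prime_factors n"
  unfolding smallest_prime_factor_def
proof (rule Min_in)
  show "prime_factors n \<noteq> {}"
    using n_gt_1 by (metis prime_factor_nat prime_factorsI less_numeral_extra(4) not_one_less_zero emptyE)
qed simp

text \<open>A zero of the symbol is a multiple of some prime factor. There are at most
  \<open>ln n\<close> such primes, each with at most \<open>n / p\<^sub>0\<close> multiples among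
  the residues.\<close>

lemma card_zeros_le:
  "real (card {k \<in> {0..<int n}. Jacobi k n = 0}) / real n \<le> ln (real n) / real (smallest_prime_factor n)"
proof -
  define p\<^sub>0 where "p\<^sub>0 = smallest_prime_factor n"
  have p0: "p\<^sub>0 > 0"
    unfolding p\<^sub>0_def using smallest_prime_factor_in by (metis in_prime_factors_imp_prime prime_gt_0_nat)
  have "{k \<in> {0..<int n}. Jacobi k n = 0} = (\<Union>p\<in>prime_factors n. {k \<in> {0..<int n}. int p dvd k})"
    using Jacobi_eq_0_iff[OF odd_n squarefree_n] by auto
  then have "card {k \<in> {0..<int n}. Jacobi k n = 0}
      \<le> (\<Sum>p\<in>prime_factors n. card {k \<in> {0..<int n}. int p dvd k})"
    by (simp add: card_UN_le)
  then have "real (card {k \<in> {0..<int n}. Jacobi k n = 0})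
      \<le> (\<Sum>p\<in>prime_factors n. real (card {k \<in> {0..<int n}. int p dvd k}))"
    by (simp flip: of_nat_sum)
  also have "\<dots> \<le> (\<Sum>p\<in>prime_factors n. real n / real p\<^sub>0)"
  proof (rule sum_mono)
    fix p assume p: "p \<in> prime_factors n"
    have "p\<^sub>0 \<le> p" unfolding p\<^sub>0_def smallest_prime_factor_def using p by (intro Min_le) auto
    have "p > 0" "p dvd n" using p p0 \<open>p\<^sub>0 \<le> p\<close> by auto
    have "real (card {k \<in> {0..<int n}. int p dvd k}) \<le> real (n div p)"
      using card_multiples_le[OF \<open>p > 0\<close> \<open>p dvd n\<close>] by simp
    also have "\<dots> \<le> real n / real p" using \<open>p dvd n\<close> by (simp add: real_of_nat_div)
    also have "\<dots> \<le> real n / real p\<^sub>0"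
      using \<open>p\<^sub>0 \<le> p\<close> p0 by (intro divide_left_mono) auto
    finally show "real (card {k \<in> {0..<int n}. int p dvd k}) \<le> real n / real p\<^sub>0" .
  qed
  also have "\<dots> = real (card (prime_factors n)) * (real n / real p\<^sub>0)" by simp
  also have "\<dots> \<le> ln (real n) * (real n / real p\<^sub>0)"
    by (intro mult_right_mono card_prime_factors_le_ln odd_n) auto
  finally show ?thesis
    using n_gt_1 unfolding p\<^sub>0_def by (simp add: divide_le_eq mult.commute)
qed

lemma real_primitive_character_Jacobi:
  "real_primitive_character n (\<lambda>x. of_int (Jacobi x n)) (of_int (Jacobi (- 1) n)) (Jacobi_Gauss_sum n)"
proof
  show "real_of_int (Jacobi x n) \<in> {-1, 0, 1}" for x
    using Jacobi_values[OF odd_n squarefree_n, of x] by auto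
  show "(real_of_int (Jacobi (- 1) n))\<^sup>2 = 1"
    using Jacobi_minus_1_square[OF odd_n squarefree_n n_gt_1] by (metis of_int_1 of_int_power)
  show "real_of_int (Jacobi (- x) n) = of_int (Jacobi (- 1) n) * of_int (Jacobi x n)" for x
    using Jacobi_minus[OF odd_n squarefree_n n_gt_1, of x] by simp
qed (use odd_gt_1_imp_ge_3 odd_n squarefree_n n_gt_1 in
  \<open>simp_all add: Jacobi_mod sum_Jacobi_root_exp norm_Jacobi_Gauss_sum cnj_Jacobi_Gauss_sum\<close>)

lemma coeff_char_poly:
  "0 \<le> m \<Longrightarrow> m < int n \<Longrightarrow> Polynomial.coeff (char_poly n) (nat m) = of_int (Jacobi m n)"
proof -
  assume m: "0 \<le> m" "m < int n"
  have "Polynomial.coeff (char_poly n) (nat m) = (\<Sum>j\<in>{1..<n}. if j = nat m then of_int (Jacobi (int j) n) else 0)"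
    by (simp add: char_poly_def coeff_sum)
  also have "\<dots> = of_int (Jacobi m n)"
  \<comment> \<open>The polynomial has no constant term, in agreement with the symbol of 0, which
    vanishes because \<open>n\<close> has a prime factor.\<close>
  proof (cases "m = 0")
    case True
    then show ?thesis
      using smallest_prime_factor_in Jacobi_eq_0_iff[OF odd_n squarefree_n, of 0] by auto
  next
    case False
    then show ?thesis using m by auto
  qed
  finally show ?thesis .
qed

lemma poly_rotation_char_poly:
  "poly (rotation n r (char_poly n)) (cis \<theta>)
    = (\<Sum>j\<in>{0..<int n}. of_int (Jacobi (j + \<lfloor>real n * r\<rfloor>) n) * cis (of_int j * \<theta>))"
proof -
  have "poly (rotation n r (char_poly n)) (cis \<theta>)
    = (\<Sum>k<n. Polynomial.coeff (char_poly n) (nat ((int k + \<lfloor>real n * r\<rfloor>) mod int n)) * cis \<theta> ^ k)"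
    by (simp add: rotation_def poly_sum poly_monom)
  also have "\<dots> = (\<Sum>k<n. of_int (Jacobi (int k + \<lfloor>real n * r\<rfloor>) n) * cis (of_int (int k) * \<theta>))"
    using n_gt_1 by (simp add: coeff_char_poly Jacobi_mod[OF odd_n squarefree_n] Complex.DeMoivre)
  also have "\<dots> = (\<Sum>j\<in>{0..<int n}. of_int (Jacobi (j + \<lfloor>real n * r\<rfloor>) n) * cis (of_int j * \<theta>))"
    by (rule sum.reindex_bij_witness[of _ nat int]) auto
  finally show ?thesis .
qed

lemma merit_factor_rotation_char_poly:
  fixes r :: real
  defines "t \<equiv> of_int ((- 2 * \<lfloor>real n * r\<rfloor>) mod int n) / real n"
  shows "\<exists>\<delta> q x. 0 \<le> \<delta> \<and> \<delta> \<le> ln (real n) / real (smallest_prime_factor n)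
    \<and> merit_factor (rotation n r (char_poly n)) = (1 - \<delta>)\<^sup>2 / (2 * q\<^sup>2) \<and> \<bar>q - sqrt x\<bar> \<le> sqrt \<delta>
    \<and> \<bar>x - (1 / 3 - t * (1 - t))\<bar> \<le> \<delta> * (4 * (ln (real n))\<^sup>2 + 2) + 2 / real n"
proof -
  interpret real_primitive_character n "\<lambda>x. of_int (Jacobi x n)" "of_int (Jacobi (- 1) n)" "Jacobi_Gauss_sum n"
    by (rule real_primitive_character_Jacobi)
  have "zeros = {k \<in> {0..<int n}. Jacobi k n = 0}" by (simp add: zeros_def)
  then have "real (card zeros) / real n \<le> ln (real n) / real (smallest_prime_factor n)"
    using card_zeros_le by simp
  moreover have "poly (rotation n r (char_poly n)) (cis \<theta>)
      = (\<Sum>j\<in>I. of_real (a \<lfloor>real n * r\<rfloor> j) * cis (of_int j * \<theta>))" for \<theta>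
    by (simp add: poly_rotation_char_poly a_def)
  note merit_factor_estimates[OF this, folded t_def]
  moreover have "0 \<le> real (card zeros) / real n" by simp
  ultimately show ?thesis by blast
qed

end

subsection \<open>The limit\<close>

text \<open>The function \<open>t * (1 - t)\<close> is continuous on the circle, also across the
  integers, where \<open>s\<close> and \<open>t\<close> may lie at opposite ends. Algebraically, the
  wrap-around contributes \<open>k * (1 - 2 * t) - k^2\<close>, which is not positive since
  \<open>\<bar>k\<bar> \<le> k^2\<close> for an integer \<open>k\<close>.\<close>

lemma parabola_mod_1_le:
  fixes s t d :: real and k :: int
  assumes "0 \<le> s" "s \<le> 1" "0 \<le> t" "t \<le> 1" "s = t + d + of_int k"
  shows "s * (1 - s) \<le> t * (1 - t) + \<bar>d\<bar> + d\<^sup>2"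
proof -
  have "of_int k * (1 - 2 * t) \<le> \<bar>of_int k\<bar> * \<bar>1 - 2 * t\<bar>"
    by (metis abs_ge_self abs_mult)
  also have "\<dots> \<le> \<bar>of_int k\<bar> * 1" using assms by (intro mult_left_mono) auto
  also have "\<dots> \<le> (of_int k)\<^sup>2"
  proof -
    have "\<bar>k\<bar> * 1 \<le> \<bar>k\<bar> * \<bar>k\<bar>"
      by (cases "k = 0") (auto intro!: mult_left_mono simp del: mult_1_right abs_mult_self_eq)
    then have "\<bar>k\<bar> \<le> \<bar>k\<bar> * \<bar>k\<bar>" by (simp only: mult_1_right)
    then have "real_of_int \<bar>k\<bar> \<le> of_int (\<bar>k\<bar> * \<bar>k\<bar>)" by (rule of_int_le_iff[THEN iffD2])
    then show ?thesis by (simp add: power2_eq_square)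
  qed
  finally have "of_int k * (1 - 2 * t) \<le> (of_int k)\<^sup>2" .
  moreover have "d * (1 - 2 * s) \<le> \<bar>d\<bar>"
  proof -
    have "d * (1 - 2 * s) \<le> \<bar>d\<bar> * \<bar>1 - 2 * s\<bar>" by (metis abs_ge_self abs_mult)
    also have "\<dots> \<le> \<bar>d\<bar> * 1" using assms by (intro mult_left_mono) auto
    finally show ?thesis by simp
  qed
  moreover have "s * (1 - s) = t * (1 - t) + (of_int k * (1 - 2 * t) - (of_int k)\<^sup>2) + d * (1 - 2 * s) + d\<^sup>2"
    unfolding assms(5) by (simp add: algebra_simps power2_eq_square)
  ultimately show ?thesis by linarith
qed

text \<open>Completing the square shows that the denominator of \<open>f_base\<close> depends only
  on \<open>-2 * r\<close> modulo 1. The closed interval is used because \<open>\<rho> = 0\<close>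
  gives \<open>y = 1\<close>.\<close>

lemma f_per_eq:
  "\<exists>y (m::int). 0 \<le> y \<and> y \<le> 1 \<and> y = - 2 * r + of_int m \<and> f_per r = 1 / (2 * (1 / 3 - y * (1 - y)))"
proof -
  define c where "c = \<lceil>r - 1 / 2\<rceil>"
  define \<rho> where "\<rho> = r - of_int c"
  have \<rho>: "- 1 / 2 < \<rho>" "\<rho> \<le> 1 / 2"
    using ceiling_correct[of "r - 1 / 2"] unfolding \<rho>_def c_def by linarith+
  have f: "f_per r = 1 / (1 / 6 + 8 * (\<bar>\<rho>\<bar> - 1 / 4)\<^sup>2)"
    by (simp add: f_per_def f_base_def \<rho>_def c_def)
  show ?thesis
  proof (cases "\<rho> < 0")
    case True
    show ?thesis
    proof (intro exI conjI)
      show "- 2 * \<rho> = - 2 * r + of_int (2 * c)" by (simp add: \<rho>_def)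
      show "f_per r = 1 / (2 * (1 / 3 - - 2 * \<rho> * (1 - - 2 * \<rho>)))"
        unfolding f using True by (simp add: power2_eq_square algebra_simps)
    qed (use True \<rho> in auto)
  next
    case False
    show ?thesis
    proof (intro exI conjI)
      show "1 - 2 * \<rho> = - 2 * r + of_int (2 * c + 1)" by (simp add: \<rho>_def)
      show "f_per r = 1 / (2 * (1 / 3 - (1 - 2 * \<rho>) * (1 - (1 - 2 * \<rho>))))"
        unfolding f using False by (simp add: power2_eq_square algebra_simps)
    qed (use False \<rho> in auto)
  qed
qed

text \<open>Modulo 1, \<open>t\<close> and \<open>y\<close> differ by twice the rounding error of
  the floor divided by \<open>n\<close>; \<open>parabola_mod_1_le\<close> is applied in both
  directions.\<close>

lemma parabola_floor_estimate:
  fixes r y :: real and m :: int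
  assumes "n > 0" "0 \<le> y" "y \<le> 1" "y = - 2 * r + of_int m"
  defines "t \<equiv> of_int ((- 2 * \<lfloor>real n * r\<rfloor>) mod int n) / real n"
  shows "\<bar>t * (1 - t) - y * (1 - y)\<bar> \<le> 2 / real n + (2 / real n)\<^sup>2"
proof -
  define R where "R = \<lfloor>real n * r\<rfloor>"
  define d where "d = 2 * (r - of_int R / real n)"
  have n: "real n > 0" using assms by simp
  have "of_int R \<le> real n * r" "real n * r \<le> of_int R + 1"
    unfolding R_def by linarith+
  then have "of_int R / real n \<le> r" "r \<le> of_int R / real n + 1 / real n"
    using n by (auto simp: field_simps)
  then have d: "\<bar>d\<bar> \<le> 2 / real n" unfolding d_def by (simp add: field_simps)
  then have d2: "d\<^sup>2 \<le> (2 / real n)\<^sup>2" by (metis abs_ge_zero power2_abs power_mono)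
  have "0 \<le> (- 2 * R) mod int n" "(- 2 * R) mod int n \<le> int n"
    using assms(1) by (auto intro: less_imp_le)
  then have "0 \<le> real_of_int ((- 2 * R) mod int n)" "real_of_int ((- 2 * R) mod int n) \<le> real n"
    by linarith+
  then have t: "0 \<le> t" "t \<le> 1" using n by (auto simp: t_def R_def)
  have "real_of_int ((- 2 * R) mod int n) = of_int (- 2 * R - int n * ((- 2 * R) div int n))"
    by (simp only: minus_mult_div_eq_mod)
  also have "\<dots> = - 2 * of_int R - real n * of_int ((- 2 * R) div int n)" by simp
  finally have t_eq: "t = - 2 * of_int R / real n - of_int ((- 2 * R) div int n)"
    unfolding t_def R_def[symmetric] using n by (simp add: field_simps)
  have "t = y + d + of_int (- ((- 2 * R) div int n) - m)"
    unfolding t_eq d_def assms(4) by simp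
  from parabola_mod_1_le[OF t assms(2,3) this]
  have 1: "t * (1 - t) \<le> y * (1 - y) + \<bar>d\<bar> + d\<^sup>2" .
  have "y = t + (- d) + of_int (((- 2 * R) div int n) + m)"
    unfolding t_eq d_def assms(4) by simp
  from parabola_mod_1_le[OF assms(2,3) t this]
  have 2: "y * (1 - y) \<le> t * (1 - t) + \<bar>d\<bar> + d\<^sup>2" by simp
  from 1 2 d d2 show ?thesis by linarith
qed

theorem theorem2:
  fixes S :: "nat set" and r :: real
  assumes "infinite S"
    and "\<forall>n\<in>S. odd n \<and> squarefree n \<and> n > 1"
    and "((\<lambda>n. (ln (real n))^3 / real (smallest_prime_factor n)) \<longlongrightarrow> 0)
           (inf sequentially (principal S))"
  shows "((\<lambda>n. merit_factor (rotation n r (char_poly n))) \<longlongrightarrow> f_per r)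
           (inf sequentially (principal S))"
proof -
  let ?F = "inf sequentially (principal S)"
  let ?\<eta> = "\<lambda>n. (ln (real n))^3 / real (smallest_prime_factor n)"
  let ?t = "\<lambda>n. of_int ((- 2 * \<lfloor>real n * r\<rfloor>) mod int n) / real n"
  have in_S: "eventually (\<lambda>n. n \<in> S) ?F"
    by (simp add: eventually_inf_principal)
  obtain y and m :: int where y: "0 \<le> y" "y \<le> 1" "y = - 2 * r + of_int m"
    and f: "f_per r = 1 / (2 * (1 / 3 - y * (1 - y)))"
    using f_per_eq by blast
  define x\<^sub>0 where "x\<^sub>0 = 1 / 3 - y * (1 - y)"
  \<comment> \<open>Hence \<open>x\<^sub>0\<close> is at least 1/12, so the denominator has a
    nonzero limit.\<close>
  have "y * (1 - y) = 1 / 4 - (y - 1 / 2)\<^sup>2" by (simp add: power2_eq_square algebra_simps)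
  then have x0: "x\<^sub>0 > 0" unfolding x\<^sub>0_def using zero_le_power2[of "y - 1 / 2"] by linarith
  have "\<forall>n\<in>S. \<exists>\<delta> q x. 0 \<le> \<delta> \<and> \<delta> \<le> ln (real n) / real (smallest_prime_factor n)
    \<and> merit_factor (rotation n r (char_poly n)) = (1 - \<delta>)\<^sup>2 / (2 * q\<^sup>2) \<and> \<bar>q - sqrt x\<bar> \<le> sqrt \<delta>
    \<and> \<bar>x - (1 / 3 - ?t n * (1 - ?t n))\<bar> \<le> \<delta> * (4 * (ln (real n))\<^sup>2 + 2) + 2 / real n"
    using merit_factor_rotation_char_poly assms(2) by blast
  then obtain \<delta> q x where est: "\<And>n. n \<in> S \<Longrightarrow> 0 \<le> \<delta> n \<and> \<delta> n \<le> ln (real n) / real (smallest_prime_factor n)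
    \<and> merit_factor (rotation n r (char_poly n)) = (1 - \<delta> n)\<^sup>2 / (2 * (q n)\<^sup>2) \<and> \<bar>q n - sqrt (x n)\<bar> \<le> sqrt (\<delta> n)
    \<and> \<bar>x n - (1 / 3 - ?t n * (1 - ?t n))\<bar> \<le> \<delta> n * (4 * (ln (real n))\<^sup>2 + 2) + 2 / real n"
    by (metis (no_types, lifting))
  have inv: "((\<lambda>n. 2 / real n) \<longlongrightarrow> 0) ?F"
    by (rule tendsto_mono[of _ sequentially]) (auto intro: lim_const_over_n)
  \<comment> \<open>One logarithm counts the prime factors and two come from the bound for
    \<open>D\<close>; together they form the cube in the hypothesis.\<close>
  have bounds: "\<delta> n \<le> ?\<eta> n" "\<delta> n * (4 * (ln (real n))\<^sup>2 + 2) \<le> 6 * ?\<eta> n" if "n \<in> S" for n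
  proof -
    have n: "odd n" "squarefree n" "n > 1" using assms(2) that by auto
    define l where "l = ln (real n)"
    define p where "p = real (smallest_prime_factor n)"
    have l: "l \<ge> 1" unfolding l_def using odd_gt_1_imp_ge_3[OF n] by (intro ln_ge_1) auto
    have p: "p \<ge> 0" by (simp add: p_def)
    have \<delta>: "0 \<le> \<delta> n" "\<delta> n \<le> l / p" using est[OF that] by (auto simp: l_def p_def)
    have "l ^ 1 \<le> l ^ 3" using l by (intro power_increasing) auto
    then have "l / p \<le> l ^ 3 / p" using p by (intro divide_right_mono) auto
    with \<delta> show "\<delta> n \<le> ?\<eta> n" by (simp add: l_def p_def)
    have "1 \<le> l\<^sup>2" using l by simp
    then have "\<delta> n * (4 * l\<^sup>2 + 2) \<le> l / p * (6 * l\<^sup>2)"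
      using \<delta> l p by (intro mult_mono) auto
    then show "\<delta> n * (4 * (ln (real n))\<^sup>2 + 2) \<le> 6 * ?\<eta> n"
      by (simp add: l_def p_def eval_nat_numeral mult_ac)
  qed
  have \<delta>: "(\<delta> \<longlongrightarrow> 0) ?F"
  proof (rule tendsto_sandwich[OF _ _ tendsto_const assms(3)])
    show "eventually (\<lambda>n. 0 \<le> \<delta> n) ?F"
      using in_S by eventually_elim (use est in blast)
    show "eventually (\<lambda>n. \<delta> n \<le> ?\<eta> n) ?F"
      using in_S by eventually_elim (rule bounds)
  qed
  have "((\<lambda>n. x n - x\<^sub>0) \<longlongrightarrow> 0) ?F"
  proof (rule Lim_null_comparison)
    \<comment> \<open>The first two terms come from \<open>est\<close> and \<open>bounds\<close>,
      the bracket from replacing \<open>?t n\<close> by \<open>y\<close>.\<close>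
    show "((\<lambda>n. 6 * ?\<eta> n + 2 / real n + (2 / real n + (2 / real n)\<^sup>2)) \<longlongrightarrow> 0) ?F"
      using tendsto_add[OF tendsto_add[OF tendsto_mult_left[OF assms(3), of 6] inv]
        tendsto_add[OF inv tendsto_power[OF inv, of 2]]] by simp
    show "eventually (\<lambda>n. norm (x n - x\<^sub>0) \<le> 6 * ?\<eta> n + 2 / real n + (2 / real n + (2 / real n)\<^sup>2)) ?F"
      using in_S
    proof eventually_elim
      case (elim n)
      have "\<bar>?t n * (1 - ?t n) - y * (1 - y)\<bar> \<le> 2 / real n + (2 / real n)\<^sup>2"
        by (rule parabola_floor_estimate) (use y assms(2) elim in auto)
      moreover have "\<bar>x n - (1 / 3 - ?t n * (1 - ?t n))\<bar> \<le> 6 * ?\<eta> n + 2 / real n"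
        using est[OF elim] bounds(2)[OF elim] by linarith
      ultimately show ?case unfolding real_norm_def x\<^sub>0_def by linarith
    qed
  qed
  then have x: "(x \<longlongrightarrow> x\<^sub>0) ?F" by (simp add: LIM_zero_iff)
  have "((\<lambda>n. q n - sqrt (x n)) \<longlongrightarrow> 0) ?F"
  proof (rule Lim_null_comparison)
    show "((\<lambda>n. sqrt (\<delta> n)) \<longlongrightarrow> 0) ?F"
      using tendsto_real_sqrt[OF \<delta>] by simp
    show "eventually (\<lambda>n. norm (q n - sqrt (x n)) \<le> sqrt (\<delta> n)) ?F"
      using in_S by eventually_elim (use est in auto)
  qed
  from tendsto_add[OF this tendsto_real_sqrt[OF x]] have q: "(q \<longlongrightarrow> sqrt x\<^sub>0) ?F" by simp
  have "((\<lambda>n. (1 - \<delta> n)\<^sup>2 / (2 * (q n)\<^sup>2)) \<longlongrightarrow> (1 - 0)\<^sup>2 / (2 * (sqrt x\<^sub>0)\<^sup>2)) ?F"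
    by (intro tendsto_intros \<delta> q) (use x0 in auto)
  also have "(1 - 0)\<^sup>2 / (2 * (sqrt x\<^sub>0)\<^sup>2) = f_per r"
    using x0 unfolding f x\<^sub>0_def[symmetric] by simp
  finally have lim: "((\<lambda>n. (1 - \<delta> n)\<^sup>2 / (2 * (q n)\<^sup>2)) \<longlongrightarrow> f_per r) ?F" .
  show ?thesis
  proof (rule Lim_transform_eventually[OF lim])
    show "eventually (\<lambda>n. (1 - \<delta> n)\<^sup>2 / (2 * (q n)\<^sup>2) = merit_factor (rotation n r (char_poly n))) ?F"
      using in_S by eventually_elim (use est in auto)
  qed
qed

end
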